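(* Let $s\in\{1,2,3,\dots\}$ and let $\alpha_0,\dots,\alpha_{2^s-1}\in\mathbb{C}$. The function $$\psi^{(s)}(x)=\sum_{k=0}^{2^s-1}\alpha_k\,\psi^{(0)}\Big(x-\frac{k}{2^s}\Big),\qquad x\in\mathbb{Q}_2,$$ is a wavelet function for the $2$-adic Haar multiresolution analysis (that is, $\{\psi^{(s)}(\cdot-a): a\in I_2\}$ is an orthonormal basis of $W_0$) if and only if there exist $\gamma_0,\dots,\gamma_{2^s-1}\in\mathbb{C}$ with $|\gamma_r|=1$ for all $r$ such that $$\alpha_k=2^{-s}(-1)^k\sum_{r=0}^{2^s-1}\gamma_r\,e^{-i\pi\frac{2r+1}{2^s}k},\qquad k=0,\dots,2^s-1.$$
   Context: $\mathbb{Q}_2$ is the field of $2$-adic numbers with norm $|\cdot|_2$ and Haar measure $dx$ normalized so that $\mathbb{Z}_2$ has measure $1$; $\mathcal{L}^2(\mathbb{Q}_2)$ is the space of complex-valued square-integrable functions. $I_2=\{2^{-\gamma}(a_0+a_1 2+\cdots+a_{\gamma-1}2^{\gamma-1}):\gamma\in\mathbb{N},\ a_j\in\{0,1\}\}\subset\mathbb{Q}_2$ (a set of representatives of $\mathbb{Q}_2/\mathbb{Z}_2$, containing $0$). Let $\phi$ be the characteristic function of $\mathbb{Z}_2=\{|x|_2\le1\}$. The $2$-adic Haar multiresolution analysis is the family $V_j=\overline{\mathrm{span}\{\phi(2^{-j}\cdot-a):a\in I_2\}}\subset\mathcal{L}^2(\mathbb{Q}_2)$, $j\in\mathbb{Z}$;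 one has $V_j\subset V_{j+1}$. $W_0$ is the orthogonal complement of $V_0$ in $V_1$. The function $\psi^{(0)}$ is $\psi^{(0)}(x)=\phi\big(\frac{x}{2}\big)-\phi\big(\frac{x}{2}-\frac12\big)$. A wavelet function for the Haar MRA is a function $\psi\in W_0$ such that $\{\psi(\cdot-a):a\in I_2\}$ is an orthonormal basis of $W_0$. *)

theory Defs
  imports "HOL-Analysis.Analysis" "HOL-Computational_Algebra.Primes"
begin

section \<open>The 2-adic absolute value on the rationals\<close>

definition abs2 :: "rat \<Rightarrow> real" where
  "abs2 q = (if q = 0 then 0
     else 2 powi (int (multiplicity 2 (snd (quotient_of q))) - int (multiplicity 2 (fst (quotient_of q)))))"

lemma abs2_0 [simp]: "abs2 0 = 0"
  by (simp add: abs2_def)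

lemma abs2_divide_of_int:
  assumes "a \<noteq> 0" "b \<noteq> 0"
  shows "abs2 (of_int a / of_int b) = 2 powi (int (multiplicity 2 b) - int (multiplicity 2 a))"
proof -
  obtain c d where cd: "quotient_of (of_int a / of_int b) = (c, d)"
    by (cases "quotient_of (of_int a / of_int b)")
  have d: "d > 0" using cd by (rule quotient_of_denom_pos)
  have eq: "(of_int a / of_int b :: rat) = of_int c / of_int d"
    using cd by (rule quotient_of_div)
  have "(of_int (a * d) :: rat) = of_int (c * b)"
    using eq assms d by (simp add: field_simps)
  hence eq2: "a * d = c * b" by (simp only: of_int_eq_iff)
  have c: "c \<noteq> 0" using eq2 assms d by auto
  have pr: "prime_elem (2::int)" by (simp add: prime_imp_prime_elem)
  have "multiplicity 2 (a * d) = multiplicity 2 a + multiplicity 2 d"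
    "multiplicity 2 (c * b) = multiplicity 2 c + multiplicity 2 b"
    using pr assms c d by (auto intro!: prime_elem_multiplicity_mult_distrib)
  hence "multiplicity 2 a + multiplicity 2 d = multiplicity 2 c + multiplicity 2 b"
    using eq2 by simp
  hence "int (multiplicity 2 d) - int (multiplicity 2 c) = int (multiplicity 2 b) - int (multiplicity 2 a)"
    by linarith
  moreover have "of_int a / of_int b \<noteq> (0::rat)" using assms by simp
  ultimately show ?thesis unfolding abs2_def cd by (auto simp: assms)
qed

lemma rat_as_quotient:
  obtains a b :: int where "(q::rat) = of_int a / of_int b" "b \<noteq> 0"
proof -
  obtain c d where cd: "quotient_of q = (c, d)" by (cases "quotient_of q")
  show ?thesis using that quotient_of_div[OF cd] quotient_of_denom_pos[OF cd] by auto
qed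

lemma abs2_pos: "q \<noteq> 0 \<Longrightarrow> abs2 q > 0"
  by (simp add: abs2_def)

lemma abs2_nonneg [simp]: "abs2 q \<ge> 0"
  using abs2_pos[of q] by (cases "q = 0") (auto)

lemma abs2_eq_0_iff [simp]: "abs2 q = 0 \<longleftrightarrow> q = 0"
  using abs2_pos[of q] by (cases "q = 0") auto

lemma abs2_mult: "abs2 (p * q) = abs2 p * abs2 q"
proof (cases "p = 0 \<or> q = 0")
  case False
  obtain a b where ab: "p = of_int a / of_int b" "b \<noteq> 0" by (rule rat_as_quotient)
  obtain c d where cd: "q = of_int c / of_int d" "d \<noteq> 0" by (rule rat_as_quotient)
  have nz: "a \<noteq> 0" "c \<noteq> 0" using ab cd False by auto
  have pr: "prime_elem (2::int)" by (simp add: prime_imp_prime_elem)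
  have m: "multiplicity 2 (a * c) = multiplicity 2 a + multiplicity 2 c"
    "multiplicity 2 (b * d) = multiplicity 2 b + multiplicity 2 d"
    using pr ab cd nz by (auto intro!: prime_elem_multiplicity_mult_distrib)
  have "p * q = of_int (a * c) / of_int (b * d)" using ab cd by simp
  hence "abs2 (p * q) = 2 powi (int (multiplicity 2 (b * d)) - int (multiplicity 2 (a * c)))"
    using abs2_divide_of_int[of "a * c" "b * d"] nz ab cd by simp
  also have "\<dots> = 2 powi ((int (multiplicity 2 b) - int (multiplicity 2 a)) + (int (multiplicity 2 d) - int (multiplicity 2 c)))"
    using m by (simp add: algebra_simps)
  also have "\<dots> = abs2 p * abs2 q"
    by (subst power_int_add) (use ab cd nz in \<open>auto simp: abs2_divide_of_int\<close>)
  finally show ?thesis .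
qed auto

lemma abs2_1 [simp]: "abs2 1 = 1"
  using abs2_divide_of_int[of 1 1] by simp

lemma abs2_minus [simp]: "abs2 (- q) = abs2 q"
proof -
  have "abs2 (- 1) * abs2 (- 1) = 1" using abs2_mult[of "- 1" "- 1"] by simp
  hence "(abs2 (- 1))\<^sup>2 = 1\<^sup>2" by (simp add: power2_eq_square)
  hence "abs2 (- 1) = 1" by (subst (asm) power2_eq_iff_nonneg) auto
  thus ?thesis using abs2_mult[of "- 1" q] by simp
qed

lemma abs2_minus_commute: "abs2 (p - q) = abs2 (q - p)"
  using abs2_minus[of "p - q"] by simp

lemma abs2_inverse: "abs2 (inverse q) = inverse (abs2 q)"
proof (cases "q = 0")
  case False
  have "abs2 (inverse q) * abs2 q = 1" using False abs2_mult[of "inverse q" q] by simp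
  thus ?thesis using False by (metis inverse_unique mult.commute)
qed simp

lemma abs2_add: "abs2 (p + q) \<le> max (abs2 p) (abs2 q)"
proof (cases "p = 0 \<or> q = 0 \<or> p + q = 0")
  case False
  obtain a b where ab: "p = of_int a / of_int b" "b \<noteq> 0" by (rule rat_as_quotient)
  obtain c d where cd: "q = of_int c / of_int d" "d \<noteq> 0" by (rule rat_as_quotient)
  define u v w where "u = a * d" and "v = c * b" and "w = b * d"
  have w: "w \<noteq> 0" using ab cd by (auto simp: w_def)
  have pu: "p = of_int u / of_int w" and qv: "q = of_int v / of_int w"
    using ab cd by (auto simp: u_def v_def w_def)
  have nz: "u \<noteq> 0" "v \<noteq> 0" using pu qv False by auto
  have pq: "p + q = of_int (u + v) / of_int w" using pu qv by (simp add: add_divide_distrib)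
  have nz2: "u + v \<noteq> 0" using pq False by auto
  define m where "m = min (multiplicity 2 u) (multiplicity 2 v)"
  have "2 ^ m dvd u" "2 ^ m dvd v" by (auto simp: m_def intro!: multiplicity_dvd')
  hence "2 ^ m dvd u + v" by simp
  hence le: "m \<le> multiplicity 2 (u + v)" using nz2 by (intro multiplicity_geI) auto
  have "abs2 (p + q) = 2 powi (int (multiplicity 2 w) - int (multiplicity 2 (u + v)))"
    unfolding pq using nz2 w by (rule abs2_divide_of_int)
  also have "\<dots> \<le> 2 powi (int (multiplicity 2 w) - int m)"
    using le by (intro power_int_increasing) auto
  also have "\<dots> \<le> max (abs2 p) (abs2 q)"
    using pu qv nz w by (auto simp: m_def min_def abs2_divide_of_int)
  finally show ?thesis .
qed (auto simp: max_def)

lemma abs2_diff: "abs2 (p - q) \<le> max (abs2 p) (abs2 q)"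
  using abs2_add[of p "- q"] by simp

lemma abs2_triangle: "abs2 (p + q) \<le> abs2 p + abs2 q"
  using abs2_add[of p q] abs2_nonneg[of p] abs2_nonneg[of q] by linarith

lemma abs2_diff_triangle: "\<bar>abs2 p - abs2 q\<bar> \<le> abs2 (p - q)"
  using abs2_triangle[of "p - q" q] abs2_triangle[of "q - p" p] abs2_minus_commute[of p q] by simp

lemma abs2_of_int_le_1: "abs2 (of_int a) \<le> 1"
proof (cases "a = 0")
  case False
  have "abs2 (of_int a) = 2 powi (- int (multiplicity 2 a))"
    using abs2_divide_of_int[of a 1] False by simp
  also have "\<dots> \<le> 2 powi 0" by (intro power_int_increasing) auto
  finally show ?thesis by simp
qed simp

lemma abs2_2: "abs2 2 = 1 / 2"
  using abs2_divide_of_int[of 2 1] by (simp add: power_int_minus field_simps)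

lemma abs2_power: "abs2 (q ^ n) = abs2 q ^ n"
  by (induction n) (auto simp: abs2_mult)

lemma abs2_odd:
  assumes "odd a"
  shows "abs2 (of_int a) = 1"
proof -
  have "multiplicity 2 a = 0" using assms by (intro not_dvd_imp_multiplicity_0) auto
  moreover have "a \<noteq> 0" using assms by auto
  ultimately show ?thesis using abs2_divide_of_int[of a 1] by simp
qed

section \<open>The field of 2-adic numbers as the completion of the rationals\<close>

definition cauchy2 :: "(nat \<Rightarrow> rat) \<Rightarrow> bool" where
  "cauchy2 X \<longleftrightarrow> (\<forall>e>0. \<exists>N. \<forall>m\<ge>N. \<forall>n\<ge>N. abs2 (X m - X n) < e)"

definition null2 :: "(nat \<Rightarrow> rat) \<Rightarrow> bool" where
  "null2 X \<longleftrightarrow> (\<lambda>n. abs2 (X n)) \<longlonglongrightarrow> 0"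

definition q2rel :: "(nat \<Rightarrow> rat) \<Rightarrow> (nat \<Rightarrow> rat) \<Rightarrow> bool" where
  "q2rel X Y \<longleftrightarrow> cauchy2 X \<and> cauchy2 Y \<and> null2 (\<lambda>n. X n - Y n)"

lemma null2_0 [simp]: "null2 (\<lambda>n. 0)"
  by (simp add: null2_def)

lemma cauchy2_const [simp]: "cauchy2 (\<lambda>n. c)"
  by (simp add: cauchy2_def)

lemma null2_minus: "null2 X \<Longrightarrow> null2 (\<lambda>n. - X n)"
  by (simp add: null2_def)

lemma null2_dominated:
  assumes "Y \<longlonglongrightarrow> 0" "\<And>n. abs2 (X n) \<le> Y n"
  shows "null2 X"
  unfolding null2_def
  by (rule tendsto_sandwich[OF _ _ tendsto_const assms(1)]) (auto simp: assms)

lemma null2_add: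
  assumes "null2 X" "null2 Y"
  shows "null2 (\<lambda>n. X n + Y n)"
proof (rule null2_dominated)
  show "(\<lambda>n. abs2 (X n) + abs2 (Y n)) \<longlonglongrightarrow> 0"
    using tendsto_add[OF assms[unfolded null2_def]] by simp
qed (rule abs2_triangle)

lemma null2_diff: "null2 X \<Longrightarrow> null2 Y \<Longrightarrow> null2 (\<lambda>n. X n - Y n)"
  using null2_add[of X "\<lambda>n. - Y n"] null2_minus[of Y] by simp

lemma cauchy2_add:
  assumes "cauchy2 X" "cauchy2 Y"
  shows "cauchy2 (\<lambda>n. X n + Y n)"
  unfolding cauchy2_def
proof (intro allI impI)
  fix e :: real assume e: "e > 0"
  obtain M where M: "\<forall>m\<ge>M. \<forall>n\<ge>M. abs2 (X m - X n) < e" using assms(1) e by (auto simp: cauchy2_def)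
  obtain N where N: "\<forall>m\<ge>N. \<forall>n\<ge>N. abs2 (Y m - Y n) < e" using assms(2) e by (auto simp: cauchy2_def)
  show "\<exists>N. \<forall>m\<ge>N. \<forall>n\<ge>N. abs2 (X m + Y m - (X n + Y n)) < e"
  proof (intro exI[of _ "max M N"] allI impI)
    fix m n assume mn: "max M N \<le> m" "max M N \<le> n"
    have "abs2 (X m + Y m - (X n + Y n)) = abs2 ((X m - X n) + (Y m - Y n))" by (simp add: algebra_simps)
    also have "\<dots> \<le> max (abs2 (X m - X n)) (abs2 (Y m - Y n))" by (rule abs2_add)
    also have "\<dots> < e" using M N mn by auto
    finally show "abs2 (X m + Y m - (X n + Y n)) < e" .
  qed
qed

lemma cauchy2_minus: "cauchy2 X \<Longrightarrow> cauchy2 (\<lambda>n. - X n)"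
  by (simp add: cauchy2_def abs2_minus_commute)

lemma cauchy2_convergent:
  assumes "cauchy2 X"
  shows "convergent (\<lambda>n. abs2 (X n))"
proof -
  have "Cauchy (\<lambda>n. abs2 (X n))"
  proof (rule metric_CauchyI)
    fix e :: real assume e: "e > 0"
    obtain M where M: "\<forall>m\<ge>M. \<forall>n\<ge>M. abs2 (X m - X n) < e" using assms(1) e by (auto simp: cauchy2_def)
    have "dist (abs2 (X m)) (abs2 (X n)) < e" if "m \<ge> M" "n \<ge> M" for m n
      using M that abs2_diff_triangle[of "X m" "X n"] by (auto simp: dist_real_def intro: le_less_trans)
    thus "\<exists>M. \<forall>m\<ge>M. \<forall>n\<ge>M. dist (abs2 (X m)) (abs2 (X n)) < e" by blast
  qed
  thus ?thesis by (simp add: Cauchy_convergent_iff)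
qed

lemma cauchy2_bounded:
  assumes "cauchy2 X"
  obtains B where "B > 0" "\<And>n. abs2 (X n) \<le> B"
proof -
  have "Bseq (\<lambda>n. abs2 (X n))" using cauchy2_convergent[OF assms] by (rule convergent_imp_Bseq)
  then obtain K where "K > 0" "\<forall>n. norm (abs2 (X n)) \<le> K" by (auto elim: BseqE)
  thus ?thesis using that[of K] by auto
qed

lemma null2_mult_bounded:
  assumes "\<And>n. abs2 (X n) \<le> B" "null2 Y"
  shows "null2 (\<lambda>n. X n * Y n)"
proof (rule null2_dominated)
  show "(\<lambda>n. B * abs2 (Y n)) \<longlonglongrightarrow> 0"
    using tendsto_mult[OF tendsto_const assms(2)[unfolded null2_def]] by simp
  show "abs2 (X n * Y n) \<le> B * abs2 (Y n)" for n
    unfolding abs2_mult by (intro mult_right_mono assms) auto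
qed

lemma cauchy2_mult:
  assumes "cauchy2 X" "cauchy2 Y"
  shows "cauchy2 (\<lambda>n. X n * Y n)"
  unfolding cauchy2_def
proof (intro allI impI)
  fix e :: real assume e: "e > 0"
  obtain A where A: "A > 0" "\<And>n. abs2 (X n) \<le> A" using cauchy2_bounded[OF assms(1)] by blast
  obtain B where B: "B > 0" "\<And>n. abs2 (Y n) \<le> B" using cauchy2_bounded[OF assms(2)] by blast
  obtain M where M: "\<forall>m\<ge>M. \<forall>n\<ge>M. abs2 (X m - X n) < e / B"
    using assms(1) e B unfolding cauchy2_def by (meson divide_pos_pos)
  obtain N where N: "\<forall>m\<ge>N. \<forall>n\<ge>N. abs2 (Y m - Y n) < e / A"
    using assms(2) e A unfolding cauchy2_def by (meson divide_pos_pos)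
  show "\<exists>N. \<forall>m\<ge>N. \<forall>n\<ge>N. abs2 (X m * Y m - X n * Y n) < e"
  proof (intro exI[of _ "max M N"] allI impI)
    fix m n assume mn: "max M N \<le> m" "max M N \<le> n"
    have "abs2 (X m * (Y m - Y n)) \<le> A * abs2 (Y m - Y n)"
      unfolding abs2_mult by (intro mult_right_mono A) auto
    also have "\<dots> < A * (e / A)" using A N mn by (intro mult_strict_left_mono) auto
    finally have 1: "abs2 (X m * (Y m - Y n)) < e" using A by simp
    have "abs2 ((X m - X n) * Y n) \<le> abs2 (X m - X n) * B"
      unfolding abs2_mult by (intro mult_left_mono B) auto
    also have "\<dots> < (e / B) * B" using B M mn by (intro mult_strict_right_mono) auto
    finally have 2: "abs2 ((X m - X n) * Y n) < e" using B by simp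
    have "abs2 (X m * Y m - X n * Y n) = abs2 (X m * (Y m - Y n) + (X m - X n) * Y n)"
      by (simp add: algebra_simps)
    also have "\<dots> \<le> max (abs2 (X m * (Y m - Y n))) (abs2 ((X m - X n) * Y n))" by (rule abs2_add)
    also have "\<dots> < e" using 1 2 by auto
    finally show "abs2 (X m * Y m - X n * Y n) < e" .
  qed
qed

lemma cauchy2_not_null:
  assumes "cauchy2 X" "\<not> null2 X"
  obtains c N where "c > 0" "\<And>n. n \<ge> N \<Longrightarrow> abs2 (X n) > c"
proof -
  obtain L where L: "(\<lambda>n. abs2 (X n)) \<longlonglongrightarrow> L"
    using cauchy2_convergent[OF assms(1)] by (auto simp: convergent_def)
  have "L \<ge> 0" by (rule LIMSEQ_le_const[OF L]) auto
  moreover have "L \<noteq> 0" using L assms(2) by (auto simp: null2_def)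
  ultimately have "L / 2 < L" "L / 2 > 0" by auto
  from order_tendstoD(1)[OF L this(1)] obtain N where "\<forall>n\<ge>N. abs2 (X n) > L / 2"
    by (auto simp: eventually_sequentially)
  thus ?thesis using that[of "L / 2" N] \<open>L / 2 > 0\<close> by auto
qed

lemma abs2_inverse_diff:
  assumes "c > 0" "abs2 x > c" "abs2 y > c"
  shows "abs2 (inverse x - inverse y) \<le> abs2 (x - y) / c\<^sup>2"
proof -
  have nz: "x \<noteq> 0" "y \<noteq> 0" using assms by auto
  have "inverse x - inverse y = inverse x * (y - x) * inverse y"
    using nz by (simp add: field_simps)
  hence "abs2 (inverse x - inverse y) = inverse (abs2 x) * abs2 (y - x) * inverse (abs2 y)"
    by (simp only: abs2_mult abs2_inverse)
  also have "\<dots> = abs2 (x - y) / (abs2 x * abs2 y)"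
    by (simp add: abs2_minus_commute[of x y] field_simps)
  also have "\<dots> \<le> abs2 (x - y) / (c * c)"
    using assms by (intro divide_left_mono mult_mono mult_pos_pos) auto
  finally show ?thesis by (simp add: power2_eq_square)
qed

lemma cauchy2_inverse:
  assumes "cauchy2 X" "\<not> null2 X"
  shows "cauchy2 (\<lambda>n. inverse (X n))"
  unfolding cauchy2_def
proof (intro allI impI)
  fix e :: real assume e: "e > 0"
  obtain c N where c: "c > 0" "\<And>n. n \<ge> N \<Longrightarrow> abs2 (X n) > c" using cauchy2_not_null[OF assms] by blast
  obtain M where M: "\<forall>m\<ge>M. \<forall>n\<ge>M. abs2 (X m - X n) < e * c\<^sup>2"
    using assms(1) e c(1) unfolding cauchy2_def by (meson mult_pos_pos zero_less_power)
  show "\<exists>N. \<forall>m\<ge>N. \<forall>n\<ge>N. abs2 (inverse (X m) - inverse (X n)) < e"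
  proof (intro exI[of _ "max M N"] allI impI)
    fix m n assume mn: "max M N \<le> m" "max M N \<le> n"
    have "abs2 (inverse (X m) - inverse (X n)) \<le> abs2 (X m - X n) / c\<^sup>2"
      using c mn by (intro abs2_inverse_diff) auto
    also have "\<dots> < e" using M mn c by (auto simp: divide_simps)
    finally show "abs2 (inverse (X m) - inverse (X n)) < e" .
  qed
qed

lemma null2_inverse_diff:
  assumes "cauchy2 X" "\<not> null2 X" "cauchy2 Y" "\<not> null2 Y" "null2 (\<lambda>n. X n - Y n)"
  shows "null2 (\<lambda>n. inverse (X n) - inverse (Y n))"
proof -
  obtain c N where c: "c > 0" "\<And>n. n \<ge> N \<Longrightarrow> abs2 (X n) > c" using cauchy2_not_null[OF assms(1,2)] by blast
  obtain d M where d: "d > 0" "\<And>n. n \<ge> M \<Longrightarrow> abs2 (Y n) > d" using cauchy2_not_null[OF assms(3,4)] by blast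
  define b where "b = min c d"
  have "(\<lambda>n. abs2 (X n - Y n) / b\<^sup>2) \<longlonglongrightarrow> 0 / b\<^sup>2"
    using assms(5) unfolding null2_def by (intro tendsto_divide tendsto_const) (use c d in \<open>auto simp: b_def\<close>)
  hence lim: "(\<lambda>n. abs2 (X n - Y n) / b\<^sup>2) \<longlonglongrightarrow> 0" by simp
  have ev: "\<forall>\<^sub>F n in sequentially. abs2 (inverse (X n) - inverse (Y n)) \<le> abs2 (X n - Y n) / b\<^sup>2"
    unfolding eventually_sequentially
  proof (intro exI[of _ "max M N"] allI impI)
    fix n assume "max M N \<le> n"
    hence "abs2 (X n) > b" "abs2 (Y n) > b" using c(2)[of n] d(2)[of n] by (auto simp: b_def)
    moreover have "b > 0" using c d by (auto simp: b_def)
    ultimately show "abs2 (inverse (X n) - inverse (Y n)) \<le> abs2 (X n - Y n) / b\<^sup>2"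
      by (intro abs2_inverse_diff)
  qed
  show ?thesis unfolding null2_def
    by (rule tendsto_sandwich[OF _ ev tendsto_const lim]) auto
qed

lemma part_equivp_q2rel: "part_equivp q2rel"
proof (rule part_equivpI)
  show "\<exists>x. q2rel x x" by (rule exI[of _ "\<lambda>n. 0"]) (simp add: q2rel_def)
  show "symp q2rel"
    by (rule sympI) (auto simp: q2rel_def null2_def abs2_minus_commute)
  show "transp q2rel"
  proof (rule transpI)
    fix X Y Z assume "q2rel X Y" "q2rel Y Z"
    thus "q2rel X Z" using null2_add[of "\<lambda>n. X n - Y n" "\<lambda>n. Y n - Z n"] by (auto simp: q2rel_def)
  qed
qed

quotient_type q2 = "nat \<Rightarrow> rat" / partial: q2rel
  morphisms rep_q2 Q2
  by (rule part_equivp_q2rel)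

lemma q2rel_refl: "cauchy2 X \<Longrightarrow> q2rel X X"
  by (simp add: q2rel_def)

lemma cr_q2_eq: "pcr_q2 = (\<lambda>x y. cauchy2 x \<and> Q2 x = y)"
  unfolding q2.pcr_cr_eq cr_q2_def q2rel_def by auto

lemma Q2_cases [cases type: q2]:
  obtains X where "x = Q2 X" "cauchy2 X"
proof (induct x)
  case (1 X)
  thus ?case by (auto simp: q2rel_def)
qed

lemma Q2_eq_iff: "cauchy2 X \<Longrightarrow> cauchy2 Y \<Longrightarrow> Q2 X = Q2 Y \<longleftrightarrow> null2 (\<lambda>n. X n - Y n)"
  using q2.rel_eq_transfer unfolding q2.pcr_cr_eq cr_q2_def rel_fun_def q2rel_def by simp

lemma Domainp_pcr_q2 [transfer_domain_rule]: "Domainp pcr_q2 = cauchy2"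
  by (simp add: q2.domain_eq q2rel_def)

instantiation q2 :: field
begin

lift_definition zero_q2 :: q2 is "\<lambda>n. 0" by (simp add: q2rel_refl)

lift_definition one_q2 :: q2 is "\<lambda>n. 1" by (simp add: q2rel_refl)

lift_definition plus_q2 :: "q2 \<Rightarrow> q2 \<Rightarrow> q2" is "\<lambda>X Y n. X n + Y n"
proof -
  fix X X' Y Y' assume "q2rel X X'" "q2rel Y Y'"
  thus "q2rel (\<lambda>n. X n + Y n) (\<lambda>n. X' n + Y' n)"
    using null2_add[of "\<lambda>n. X n - X' n" "\<lambda>n. Y n - Y' n"]
    by (auto simp: q2rel_def cauchy2_add algebra_simps)
qed

lift_definition uminus_q2 :: "q2 \<Rightarrow> q2" is "\<lambda>X n. - X n"
proof -
  fix X X' assume "q2rel X X'"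
  thus "q2rel (\<lambda>n. - X n) (\<lambda>n. - X' n)"
    using null2_minus[of "\<lambda>n. X n - X' n"] by (auto simp: q2rel_def cauchy2_minus)
qed

lift_definition times_q2 :: "q2 \<Rightarrow> q2 \<Rightarrow> q2" is "\<lambda>X Y n. X n * Y n"
proof -
  fix X X' Y Y' assume *: "q2rel X X'" "q2rel Y Y'"
  obtain A where A: "\<And>n. abs2 (X n) \<le> A" using * cauchy2_bounded by (metis q2rel_def)
  obtain B where B: "\<And>n. abs2 (Y' n) \<le> B" using * cauchy2_bounded by (metis q2rel_def)
  have "null2 (\<lambda>n. X n * (Y n - Y' n) + Y' n * (X n - X' n))"
    using * A B by (intro null2_add null2_mult_bounded) (auto simp: q2rel_def)
  hence "null2 (\<lambda>n. X n * Y n - X' n * Y' n)" by (simp add: algebra_simps)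
  thus "q2rel (\<lambda>n. X n * Y n) (\<lambda>n. X' n * Y' n)" using * by (auto simp: q2rel_def cauchy2_mult)
qed

lift_definition inverse_q2 :: "q2 \<Rightarrow> q2"
  is "\<lambda>X. if null2 X then (\<lambda>n. 0) else (\<lambda>n. inverse (X n))"
proof -
  fix X Y assume *: "q2rel X Y"
  have "null2 X \<longleftrightarrow> null2 Y"
    using null2_diff[of X "\<lambda>n. X n - Y n"] null2_add[of Y "\<lambda>n. X n - Y n"] * by (auto simp: q2rel_def)
  thus "q2rel (if null2 X then (\<lambda>n. 0) else (\<lambda>n. inverse (X n)))
     (if null2 Y then (\<lambda>n. 0) else (\<lambda>n. inverse (Y n)))"
    using * by (auto simp: q2rel_def cauchy2_inverse null2_inverse_diff)
qed

definition "x - y = x + - y" for x y :: q2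

definition "x div y = x * inverse y" for x y :: q2

instance
proof
  fix a b c :: q2
  show "a + b = b + a"
    by transfer (simp add: ac_simps q2rel_refl cauchy2_add)
  show "(a + b) + c = a + (b + c)"
    by transfer (simp add: ac_simps q2rel_refl cauchy2_add)
  show "0 + a = a"
    by transfer (simp add: q2rel_refl)
  show "- a + a = 0"
    by transfer (simp add: q2rel_refl)
  show "a - b = a + - b"
    by (rule minus_q2_def)
  show "(a * b) * c = a * (b * c)"
    by transfer (simp add: ac_simps q2rel_refl cauchy2_mult)
  show "a * b = b * a"
    by transfer (simp add: ac_simps q2rel_refl cauchy2_mult)
  show "1 * a = a"
    by transfer (simp add: q2rel_refl)
  show "(a + b) * c = a * c + b * c"
    by transfer (simp add: distrib_right q2rel_refl cauchy2_add cauchy2_mult)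
  show "(0::q2) \<noteq> 1"
    by transfer (simp add: q2rel_def null2_def LIMSEQ_const_iff)
  have "null2 (\<lambda>n. inverse (X n) * X n - 1)" if X: "cauchy2 X" "\<not> null2 X" for X
  proof -
    obtain c N where c: "c > 0" "\<And>n. n \<ge> N \<Longrightarrow> abs2 (X n) > c" using cauchy2_not_null[OF X] by blast
    have "\<forall>\<^sub>F n in sequentially. abs2 (inverse (X n) * X n - 1) = 0"
      unfolding eventually_sequentially
    proof (intro exI[of _ N] allI impI)
      fix n assume "N \<le> n"
      hence "X n \<noteq> 0" using c(1) c(2)[of n] by auto
      thus "abs2 (inverse (X n) * X n - 1) = 0" by simp
    qed
    thus ?thesis unfolding null2_def by (rule tendsto_eventually)
  qed
  thus "a \<noteq> 0 \<Longrightarrow> inverse a * a = 1"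
    by transfer (auto simp: q2rel_def cauchy2_mult cauchy2_inverse)
  show "a div b = a * inverse b"
    by (rule divide_q2_def)
  show "inverse (0::q2) = 0"
    by transfer (simp add: q2rel_refl)
qed

end

lift_definition norm2 :: "q2 \<Rightarrow> real" is "\<lambda>X. lim (\<lambda>n. abs2 (X n))"
proof -
  fix X Y assume *: "q2rel X Y"
  obtain L where L: "(\<lambda>n. abs2 (X n)) \<longlonglongrightarrow> L"
    using cauchy2_convergent * by (auto simp: convergent_def q2rel_def)
  have "(\<lambda>n. abs2 (X n) - abs2 (Y n)) \<longlonglongrightarrow> 0"
  proof (rule Lim_null_comparison)
    show "(\<lambda>n. abs2 (X n - Y n)) \<longlonglongrightarrow> 0" using * by (simp add: q2rel_def null2_def)
    show "\<forall>\<^sub>F n in sequentially. norm (abs2 (X n) - abs2 (Y n)) \<le> abs2 (X n - Y n)"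
      by (simp add: abs2_diff_triangle)
  qed
  from tendsto_diff[OF L this] have "(\<lambda>n. abs2 (Y n)) \<longlonglongrightarrow> L" by simp
  thus "lim (\<lambda>n. abs2 (X n)) = lim (\<lambda>n. abs2 (Y n))" using L by (simp add: limI)
qed

lemma norm2_Q2: "cauchy2 X \<Longrightarrow> (\<lambda>n. abs2 (X n)) \<longlonglongrightarrow> norm2 (Q2 X)"
  using norm2.transfer cauchy2_convergent[of X]
  by (auto simp: cr_q2_eq rel_fun_def convergent_LIMSEQ_iff)

lemma Q2_add: "cauchy2 X \<Longrightarrow> cauchy2 Y \<Longrightarrow> Q2 X + Q2 Y = Q2 (\<lambda>n. X n + Y n)"
  using plus_q2.transfer by (simp add: cr_q2_eq rel_fun_def)

lemma Q2_minus: "cauchy2 X \<Longrightarrow> - Q2 X = Q2 (\<lambda>n. - X n)"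
  using uminus_q2.transfer by (simp add: cr_q2_eq rel_fun_def)

lemma Q2_diff: "cauchy2 X \<Longrightarrow> cauchy2 Y \<Longrightarrow> Q2 X - Q2 Y = Q2 (\<lambda>n. X n - Y n)"
  by (simp add: minus_q2_def Q2_add Q2_minus cauchy2_minus)

lemma Q2_mult: "cauchy2 X \<Longrightarrow> cauchy2 Y \<Longrightarrow> Q2 X * Q2 Y = Q2 (\<lambda>n. X n * Y n)"
  using times_q2.transfer by (simp add: cr_q2_eq rel_fun_def)

lemma Q2_0: "Q2 (\<lambda>n. 0) = 0"
  using zero_q2.transfer by (simp add: cr_q2_eq)

lemma Q2_1: "Q2 (\<lambda>n. 1) = 1"
  using one_q2.transfer by (simp add: cr_q2_eq)

lemma norm2_nonneg [simp]: "norm2 (x::q2) \<ge> 0"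
proof (cases x)
  case (1 X)
  thus ?thesis using LIMSEQ_le_const[OF norm2_Q2[of X], of 0] by auto
qed

lemma norm2_eq_0_iff [simp]: "norm2 (x::q2) = 0 \<longleftrightarrow> x = 0"
proof (cases x)
  case (1 X)
  have "norm2 x = 0 \<longleftrightarrow> null2 X"
    using norm2_Q2[OF 1(2)] 1 LIMSEQ_unique by (auto simp: null2_def)
  also have "\<dots> \<longleftrightarrow> x = 0" unfolding 1 Q2_0[symmetric] using 1 by (subst Q2_eq_iff) auto
  finally show ?thesis .
qed

lemma norm2_0 [simp]: "norm2 (0::q2) = 0"
  by simp

lemma norm2_add: "norm2 (x + y :: q2) \<le> max (norm2 x) (norm2 y)"
proof (cases x)
  case X: (1 X)
  show ?thesis
  proof (cases y)
    case Y: (1 Y)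
    have "(\<lambda>n. max (abs2 (X n)) (abs2 (Y n))) \<longlonglongrightarrow> max (norm2 x) (norm2 y)"
      using X Y by (auto intro!: tendsto_max norm2_Q2)
    moreover have "(\<lambda>n. abs2 (X n + Y n)) \<longlonglongrightarrow> norm2 (x + y)"
      using X Y by (simp add: Q2_add norm2_Q2 cauchy2_add)
    ultimately show ?thesis by (intro LIMSEQ_le) (auto simp: abs2_add)
  qed
qed

lemma norm2_minus [simp]: "norm2 (- x :: q2) = norm2 x"
proof (cases x)
  case X: (1 X)
  have "(\<lambda>n. abs2 (X n)) \<longlonglongrightarrow> norm2 (- x)"
    using X norm2_Q2[of "\<lambda>n. - X n"] by (simp add: Q2_minus cauchy2_minus)
  moreover have "(\<lambda>n. abs2 (X n)) \<longlonglongrightarrow> norm2 x" using X norm2_Q2 by simp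
  ultimately show ?thesis by (rule LIMSEQ_unique)
qed

lemma norm2_diff: "norm2 (x - y :: q2) \<le> max (norm2 x) (norm2 y)"
  using norm2_add[of x "- y"] by simp

lemma norm2_minus_commute: "norm2 (x - y :: q2) = norm2 (y - x)"
  using norm2_minus[of "x - y"] by simp

lemma norm2_mult: "norm2 (x * y :: q2) = norm2 x * norm2 y"
proof (cases x)
  case X: (1 X)
  show ?thesis
  proof (cases y)
    case Y: (1 Y)
    have "(\<lambda>n. abs2 (X n) * abs2 (Y n)) \<longlonglongrightarrow> norm2 x * norm2 y"
      using X Y by (auto intro!: tendsto_mult norm2_Q2)
    moreover have "(\<lambda>n. abs2 (X n) * abs2 (Y n)) \<longlonglongrightarrow> norm2 (x * y)"
      using X Y norm2_Q2[of "\<lambda>n. X n * Y n"] by (simp add: Q2_mult cauchy2_mult abs2_mult)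
    ultimately show ?thesis using LIMSEQ_unique by blast
  qed
qed

lemma of_nat_q2: "of_nat k = Q2 (\<lambda>n. of_nat k)"
  by (induction k) (auto simp: Q2_0 Q2_1[symmetric] Q2_add)

instance q2 :: field_char_0
proof
  show "inj (of_nat :: nat \<Rightarrow> q2)"
  proof (rule injI)
    fix k l :: nat assume "(of_nat k :: q2) = of_nat l"
    hence "null2 (\<lambda>n. of_nat k - of_nat l)" unfolding of_nat_q2 by (simp add: Q2_eq_iff)
    thus "k = l" by (simp add: null2_def LIMSEQ_const_iff)
  qed
qed

lemma of_int_q2: "of_int k = Q2 (\<lambda>n. of_int k)"
  by (cases k rule: int_diff_cases) (simp add: of_nat_q2 Q2_diff)

lemma of_rat_q2: "of_rat q = Q2 (\<lambda>n. q)"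
proof -
  obtain a b where ab: "q = of_int a / of_int b" "b \<noteq> 0" by (rule rat_as_quotient)
  have "(of_rat q :: q2) = of_int a / of_int b" using ab by (simp add: of_rat_divide)
  moreover have "Q2 (\<lambda>n. q) * of_int b = of_int a" unfolding of_int_q2 using ab by (simp add: Q2_mult)
  ultimately show ?thesis using ab(2)
    by (metis divide_eq_eq of_int_eq_0_iff)
qed

lemma norm2_of_rat: "norm2 (of_rat q :: q2) = abs2 q"
  using norm2_Q2[of "\<lambda>n. q"] unfolding of_rat_q2 by (simp add: LIMSEQ_const_iff)

instantiation q2 :: metric_space
begin

definition dist_q2 :: "q2 \<Rightarrow> q2 \<Rightarrow> real" where
  "dist_q2 x y = norm2 (x - y)"

definition uniformity_q2 :: "(q2 \<times> q2) filter" where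
  "uniformity_q2 = (INF e\<in>{0 <..}. principal {(x, y). dist x y < e})"

definition open_q2 :: "q2 set \<Rightarrow> bool" where
  "open_q2 U \<longleftrightarrow> (\<forall>x\<in>U. \<forall>\<^sub>F (x', y) in uniformity. x' = x \<longrightarrow> y \<in> U)"

instance
proof
  fix x y z :: q2
  show "dist x y = 0 \<longleftrightarrow> x = y" by (simp add: dist_q2_def)
  have "norm2 (x - y) \<le> max (norm2 (x - z)) (norm2 (y - z))"
    using norm2_diff[of "x - z" "y - z"] by simp
  thus "dist x y \<le> dist x z + dist y z"
    unfolding dist_q2_def using norm2_nonneg[of "x - z"] norm2_nonneg[of "y - z"] by linarith
qed (simp_all add: uniformity_q2_def open_q2_def)

end


lemma dist_q2_norm2: "dist x y = norm2 (x - y)"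
  by (rule dist_q2_def)

lemma q2_rat_dense:
  assumes "e > 0"
  obtains q where "norm2 (x - of_rat q) < e"
proof (cases x)
  case (1 X)
  obtain N where N: "\<forall>m\<ge>N. \<forall>n\<ge>N. abs2 (X m - X n) < e / 2"
    using 1(2) assms unfolding cauchy2_def by (meson half_gt_zero)
  have c: "cauchy2 (\<lambda>n. X n - X N)" using cauchy2_add[OF 1(2) cauchy2_const[of "- X N"]] by simp
  have "(\<lambda>n. abs2 (X n - X N)) \<longlonglongrightarrow> norm2 (x - of_rat (X N))"
    unfolding of_rat_q2 using 1 norm2_Q2[OF c] by (simp add: Q2_diff)
  hence "norm2 (x - of_rat (X N)) \<le> e / 2"
    by (rule LIMSEQ_le_const2) (use N in \<open>auto intro!: exI[of _ N] less_imp_le\<close>)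
  thus ?thesis using that[of "X N"] assms by simp
qed

instance q2 :: complete_space
proof
  fix x :: "nat \<Rightarrow> q2" assume x: "Cauchy x"
  have "\<forall>n. \<exists>q. norm2 (x n - of_rat q) < 1 / 2 ^ n"
    by (metis q2_rat_dense zero_less_divide_1_iff zero_less_numeral zero_less_power)
  then obtain q where q: "\<And>n. norm2 (x n - of_rat (q n)) < 1 / 2 ^ n" by metis
  have small: "\<exists>N. \<forall>n\<ge>N. norm2 (x n - of_rat (q n)) < e" if e: "e > 0" for e
  proof -
    obtain N where N: "(1 / 2) ^ N < e" using real_arch_pow_inv[of e "1 / 2"] e by auto
    have "norm2 (x n - of_rat (q n)) < e" if "n \<ge> N" for n
    proof -
      have "(1 / 2) ^ n \<le> (1 / 2 :: real) ^ N" using that by (intro power_decreasing) auto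
      thus ?thesis using q[of n] N by (simp add: power_one_over)
    qed
    thus ?thesis by blast
  qed
  have cq: "cauchy2 q" unfolding cauchy2_def
  proof (intro allI impI)
    fix e :: real assume e: "e > 0"
    obtain N where N: "\<And>n. n \<ge> N \<Longrightarrow> norm2 (x n - of_rat (q n)) < e" using small[OF e] by blast
    obtain M where M: "\<And>m n. m \<ge> M \<Longrightarrow> n \<ge> M \<Longrightarrow> norm2 (x m - x n) < e"
      using metric_CauchyD[OF x e] by (auto simp: dist_q2_norm2)
    show "\<exists>N. \<forall>m\<ge>N. \<forall>n\<ge>N. abs2 (q m - q n) < e"
    proof (intro exI[of _ "max M N"] allI impI)
      fix m n assume mn: "max M N \<le> m" "max M N \<le> n"
      have "norm2 ((x m - x n) + (x n - of_rat (q n)) - (x m - of_rat (q m)))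
          \<le> max (max (norm2 (x m - x n)) (norm2 (x n - of_rat (q n)))) (norm2 (x m - of_rat (q m)))"
        by (rule order_trans[OF norm2_diff max.mono[OF norm2_add order_refl]])
      also have "\<dots> < e" using mn M[of m n] N[of m] N[of n] by simp
      finally have "norm2 (of_rat (q m) - of_rat (q n)) < e" by (simp add: algebra_simps)
      thus "abs2 (q m - q n) < e" by (simp add: norm2_of_rat flip: of_rat_diff)
    qed
  qed
  have "x \<longlonglongrightarrow> Q2 q"
  proof (rule metric_LIMSEQ_I)
    fix e :: real assume e: "e > 0"
    obtain N where N: "\<And>n. n \<ge> N \<Longrightarrow> norm2 (x n - of_rat (q n)) < e" using small[OF e] by blast
    obtain M where M: "\<And>m n. m \<ge> M \<Longrightarrow> n \<ge> M \<Longrightarrow> abs2 (q m - q n) < e / 2"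
      using cq e unfolding cauchy2_def by (meson half_gt_zero)
    have "dist (x n) (Q2 q) < e" if n: "n \<ge> max M N" for n
    proof -
      have c: "cauchy2 (\<lambda>k. q n - q k)" using cauchy2_add[OF cauchy2_const[of "q n"] cauchy2_minus[OF cq]] by simp
      have "(\<lambda>k. abs2 (q n - q k)) \<longlonglongrightarrow> norm2 (of_rat (q n) - Q2 q)"
        unfolding of_rat_q2 using norm2_Q2[OF c] cq by (simp add: Q2_diff)
      hence "norm2 (of_rat (q n) - Q2 q) \<le> e / 2"
        by (rule LIMSEQ_le_const2) (use M n in \<open>auto intro!: exI[of _ M] less_imp_le\<close>)
      moreover have "norm2 ((x n - of_rat (q n)) + (of_rat (q n) - Q2 q))
          \<le> max (norm2 (x n - of_rat (q n))) (norm2 (of_rat (q n) - Q2 q))"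
        by (rule norm2_add)
      ultimately show ?thesis using N[of n] n e by (simp add: dist_q2_norm2)
    qed
    thus "\<exists>N. \<forall>n\<ge>N. dist (x n) (Q2 q) < e" by blast
  qed
  thus "convergent x" by (auto simp: convergent_def)
qed

section \<open>Haar measure\<close>

definition Z2 :: "q2 set" where
  "Z2 = {x. norm2 x \<le> 1}"

text \<open>The normalization on the compact open set \<open>Z2\<close> makes the measure finite on all compact sets.
  Existence and uniqueness: \<open>ex1_haar2\<close>.\<close>

definition is_haar2 :: "q2 measure \<Rightarrow> bool" where
  "is_haar2 M \<longleftrightarrow> sets M = sets borel \<and> emeasure M Z2 = 1 \<and>
     (\<forall>a. \<forall>A\<in>sets borel. emeasure M ((\<lambda>x. a + x) ` A) = emeasure M A)"

definition haar2 :: "q2 measure" where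
  "haar2 = (THE M. is_haar2 M)"

subsection \<open>Existence and uniqueness\<close>

lemma cball_q2: "cball x r = {y. norm2 (y - x) \<le> r}"
  by (auto simp: dist_q2_norm2 norm2_minus_commute)

lemma cball_q2_subset:
  fixes x x' y :: q2
  assumes "y \<in> cball x r" "y \<in> cball x' r'" "r \<le> r'"
  shows "cball x r \<subseteq> cball x' r'"
proof
  fix z assume z: "z \<in> cball x r"
  have "norm2 ((z - x) - (y - x)) \<le> max (norm2 (z - x)) (norm2 (y - x))" by (rule norm2_diff)
  also have "\<dots> \<le> r" using z assms(1) by (simp add: cball_q2)
  finally have 1: "norm2 (z - y) \<le> r'" using assms(3) by simp
  have "norm2 ((z - y) + (y - x')) \<le> max (norm2 (z - y)) (norm2 (y - x'))" by (rule norm2_add)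
  also have "\<dots> \<le> r'" using 1 assms(2) by (simp add: cball_q2)
  finally show "z \<in> cball x' r'" by (simp add: cball_q2)
qed

lemma cball_q2_eq: "y \<in> cball x r \<Longrightarrow> cball y r = cball x r" for x y :: q2
  by (metis cball_q2_subset antisym centre_in_cball empty_iff cball_eq_empty linorder_not_le order_refl)

lemma norm2_2: "norm2 2 = 1 / 2"
  using norm2_of_rat[of 2] by (simp add: abs2_2)

lemma norm2_power: "norm2 (x ^ n) = norm2 x ^ n"
  using norm2_of_rat[of 1] by (induction n) (auto simp: norm2_mult)

lemma norm2_2_power: "norm2 (2 ^ n) = 1 / 2 ^ n"
  by (simp add: norm2_power norm2_2 power_one_over)

lemma abs2_le_1_cases:
  assumes "abs2 u \<le> 1"
  shows "abs2 u \<le> 1 / 2 \<or> abs2 (u - 1) \<le> 1 / 2"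
proof -
  obtain a b where ab: "quotient_of u = (a, b)" by (cases "quotient_of u")
  have b: "b > 0" using ab by (rule quotient_of_denom_pos)
  have co: "coprime a b" using ab by (rule quotient_of_coprime)
  have u: "u = of_int a / of_int b" using ab by (rule quotient_of_div)
  have ub: "u * of_int b = of_int a" using u b by simp
  have even: "abs2 (of_int k) \<le> 1 / 2" if k: "even k" for k :: int
  proof -
    obtain l where "k = 2 * l" using k by (rule evenE)
    thus ?thesis using abs2_of_int_le_1[of l] by (simp add: abs2_mult abs2_2)
  qed
  have ob: "odd b"
  proof
    assume "even b"
    hence "odd a" using co by (metis coprime_common_divisor odd_one)
    hence "abs2 u * abs2 (of_int b) = 1" using ub abs2_odd[of a] by (metis abs2_mult)
    moreover have "abs2 u * abs2 (of_int b) \<le> 1 * (1 / 2)"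
      using assms even[OF \<open>even b\<close>] by (intro mult_mono) auto
    ultimately show False by simp
  qed
  show ?thesis
  proof (cases "even a")
    case True
    thus ?thesis using even[of a] ub abs2_mult[of u "of_int b"] abs2_odd[OF ob] by simp
  next
    case False
    have "(u - 1) * of_int b = of_int (a - b)" using ub by (simp add: algebra_simps)
    hence "abs2 (u - 1) = abs2 (of_int (a - b))" using abs2_mult[of "u - 1" "of_int b"] abs2_odd[OF ob] by simp
    thus ?thesis using even[of "a - b"] False ob by simp
  qed
qed

text \<open>\<open>bitrev\<close> maps \<open>\<Sum>i. b\<^sub>i 2^i\<close> to \<open>\<Sum>i. b\<^sub>i 2^(-i-1)\<close>, which enumerates the representatives of
  the quotient of the 2-adic numbers by the 2-adic integers.\<close>

fun bitrev :: "nat \<Rightarrow> rat" where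
  "bitrev n = (if n = 0 then 0 else (of_nat (n mod 2) + bitrev (n div 2)) / 2)"

declare bitrev.simps [simp del]

lemma bitrev_0 [simp]: "bitrev 0 = 0"
  by (simp add: bitrev.simps)

lemma bitrev_double: "2 * bitrev n = of_nat (n mod 2) + bitrev (n div 2)"
  by (cases "n = 0") (simp, subst bitrev.simps, simp)

lemma bitrev_surj_aux:
  assumes "abs2 (2 ^ k * q) \<le> 1"
  shows "\<exists>n. abs2 (q - bitrev n) \<le> 1"
  using assms
proof (induction k arbitrary: q)
  case 0
  thus ?case by (intro exI[of _ 0]) auto
next
  case (Suc k)
  have "abs2 (2 ^ k * (2 * q)) \<le> 1" using Suc.prems by (simp add: mult_ac)
  then obtain n where n: "abs2 (2 * q - bitrev n) \<le> 1" using Suc.IH by blast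
  have half: "\<exists>n. abs2 (q - bitrev n) \<le> 1" if "abs2 (2 * q - bitrev n - of_nat b) \<le> 1 / 2" "b < 2" for b
  proof -
    have "2 * (q - bitrev (2 * n + b)) = 2 * q - bitrev n - of_nat b"
      using bitrev_double[of "2 * n + b"] that(2) by (simp add: algebra_simps)
    hence "abs2 (2 * (q - bitrev (2 * n + b))) \<le> 1 / 2" using that(1) by (simp only:)
    hence "abs2 (q - bitrev (2 * n + b)) \<le> 1" unfolding abs2_mult abs2_2 by simp
    thus ?thesis by blast
  qed
  show ?case using abs2_le_1_cases[OF n] half[of 0] half[of 1] by auto
qed

lemma bitrev_surj: "\<exists>n. norm2 (x - of_rat (bitrev n)) \<le> 1"
proof -
  obtain q where q: "norm2 (x - of_rat q) < 1" using q2_rat_dense[of 1 x] by auto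
  obtain k where k: "abs2 q < 2 ^ k" using real_arch_pow[of 2 "abs2 q"] by auto
  have "abs2 (2 ^ k * q) \<le> 1" using k by (simp add: abs2_mult abs2_power abs2_2 power_one_over)
  then obtain n where n: "abs2 (q - bitrev n) \<le> 1" using bitrev_surj_aux by blast
  have "norm2 ((x - of_rat q) + (of_rat q - of_rat (bitrev n)))
      \<le> max (norm2 (x - of_rat q)) (norm2 (of_rat q - of_rat (bitrev n)))" by (rule norm2_add)
  also have "\<dots> \<le> 1" using q n by (simp add: norm2_of_rat flip: of_rat_diff)
  finally show ?thesis by auto
qed

lemma bitrev_inj: "abs2 (bitrev m - bitrev n) \<le> 1 \<Longrightarrow> m = n"
proof (induction "m + n" arbitrary: m n rule: less_induct)
  case less
  show ?case
  proof (cases "m = 0 \<and> n = 0")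
    case False
    define d where "d = int (m mod 2) - int (n mod 2)"
    have eq: "bitrev (m div 2) - bitrev (n div 2) = 2 * (bitrev m - bitrev n) - of_int d"
      using bitrev_double[of m] bitrev_double[of n] by (simp add: d_def algebra_simps)
    have small: "abs2 (2 * (bitrev m - bitrev n)) \<le> 1 / 2"
      using less.prems unfolding abs2_mult abs2_2 by simp
    have "abs2 (bitrev (m div 2) - bitrev (n div 2)) \<le> 1"
      unfolding eq using small abs2_of_int_le_1[of d] by (intro order_trans[OF abs2_diff]) auto
    moreover have "m div 2 + n div 2 < m + n" using False by linarith
    ultimately have div: "m div 2 = n div 2" using less.hyps by blast
    hence "of_int d = 2 * (bitrev m - bitrev n)" using eq by simp
    hence "abs2 (of_int d) \<le> 1 / 2" using small by simp
    hence "even d" using abs2_odd[of d] by (cases "even d") auto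
    hence mod: "m mod 2 = n mod 2"
      unfolding d_def by (cases "even m"; cases "even n") (simp_all add: mod_2_eq_odd)
    have "m = m div 2 * 2 + m mod 2" by simp
    also have "\<dots> = n div 2 * 2 + n mod 2" by (simp only: div mod)
    also have "\<dots> = n" by simp
    finally show ?thesis .
  qed simp
qed

definition qball :: "nat \<Rightarrow> nat \<Rightarrow> q2 set" where
  "qball n k = cball (2 ^ n * of_rat (bitrev k)) (1 / 2 ^ n)"

lemma qball_borel: "qball n k \<in> sets borel"
  by (simp add: qball_def)

lemma in_qball_iff: "y \<in> qball n k \<longleftrightarrow> norm2 (y / 2 ^ n - of_rat (bitrev k)) \<le> 1"
proof -
  have "y - 2 ^ n * of_rat (bitrev k) = 2 ^ n * (y / 2 ^ n - of_rat (bitrev k))" by (simp add: algebra_simps)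
  hence "norm2 (y - 2 ^ n * of_rat (bitrev k)) = norm2 (y / 2 ^ n - of_rat (bitrev k)) / 2 ^ n"
    by (simp only: norm2_mult norm2_2_power) simp
  thus ?thesis by (simp add: qball_def cball_q2 divide_simps)
qed

lemma qball_cover: "\<exists>k. y \<in> qball n k"
  unfolding in_qball_iff by (rule bitrev_surj)

lemma cball_q2_qball: "\<exists>k. cball x (1 / 2 ^ n) = qball n k"
  using qball_cover[of x n] unfolding qball_def by (metis cball_q2_eq)

lemma qball_unique:
  assumes "y \<in> qball n k" "y \<in> qball n l"
  shows "k = l"
proof -
  have "norm2 ((y / 2 ^ n - of_rat (bitrev l)) - (y / 2 ^ n - of_rat (bitrev k)))
      \<le> max (norm2 (y / 2 ^ n - of_rat (bitrev l))) (norm2 (y / 2 ^ n - of_rat (bitrev k)))"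
    by (rule norm2_diff)
  also have "\<dots> \<le> 1" using assms by (simp add: in_qball_iff)
  finally show ?thesis by (intro bitrev_inj) (simp add: norm2_of_rat flip: of_rat_diff)
qed

lemma qball_Int:
  "qball m k \<inter> qball n l \<in> insert {} (range (case_prod qball))"
proof (cases "qball m k \<inter> qball n l = {}")
  case False
  then obtain y where y: "y \<in> qball m k" "y \<in> qball n l" by blast
  have "qball m k \<subseteq> qball n l \<or> qball n l \<subseteq> qball m k"
  proof (cases "m \<le> n")
    case True
    have "1 / 2 ^ n \<le> 1 / (2 ^ m :: real)" using True by (simp add: field_simps)
    thus ?thesis using y cball_q2_subset unfolding qball_def by blast
  next
    case False
    have "1 / 2 ^ m \<le> 1 / (2 ^ n :: real)" using False by (simp add: field_simps)
    thus ?thesis using y cball_q2_subset unfolding qball_def by blast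
  qed
  hence "qball m k \<inter> qball n l \<in> {qball m k, qball n l}" by blast
  thus ?thesis by (auto intro: range_eqI[of _ _ "(m, k)"] range_eqI[of _ _ "(n, l)"])
qed simp

lemma Int_stable_qball: "Int_stable (insert {} (range (case_prod qball)))"
proof (rule Int_stableI)
  fix A B assume "A \<in> insert {} (range (case_prod qball))" "B \<in> insert {} (range (case_prod qball))"
  then consider "A = {} \<or> B = {}" | m k n l where "A = qball m k" "B = qball n l" by auto
  thus "A \<inter> B \<in> insert {} (range (case_prod qball))"
    by cases (use qball_Int in auto)
qed

lemma sets_borel_q2: "sets (borel :: q2 measure) = sigma_sets UNIV (insert {} (range (case_prod qball)))"
proof -
  have "(borel :: q2 measure) = sigma UNIV ((\<lambda>A. A) ` insert {} (range (case_prod qball)))"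
  proof (rule borel_eq_sigmaI1[where X = "{S. open S}"])
    show "(borel :: q2 measure) = sigma UNIV {S. open S}" by (rule borel_def)
  next
    fix S :: "q2 set" assume "S \<in> {S. open S}"
    hence S: "open S" by simp
    have "S = (\<Union>p\<in>{p. case_prod qball p \<subseteq> S}. case_prod qball p)"
    proof (intro equalityI subsetI)
      fix y assume y: "y \<in> S"
      obtain e where e: "e > 0" "ball y e \<subseteq> S" using S y by (auto elim: openE)
      obtain n where n: "(1 / 2) ^ n < e" using real_arch_pow_inv[of e "1 / 2"] e by auto
      obtain k where k: "y \<in> qball n k" using qball_cover by blast
      have "qball n k = cball y (1 / 2 ^ n)" using k unfolding qball_def by (metis cball_q2_eq)
      also have "\<dots> \<subseteq> ball y e" using n by (auto simp: power_one_over)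
      finally show "y \<in> (\<Union>p\<in>{p. case_prod qball p \<subseteq> S}. case_prod qball p)" using k e by fastforce
    qed auto
    also have "\<dots> \<in> sets (sigma UNIV ((\<lambda>A. A) ` insert {} (range (case_prod qball))))"
      by (intro sets.countable_UN' countableI_type) auto
    finally show "S \<in> sets (sigma UNIV ((\<lambda>A. A) ` insert {} (range (case_prod qball))))" .
  next
    fix A assume "A \<in> insert {} (range (case_prod qball))"
    thus "A \<in> sets (borel :: q2 measure)" by (auto simp: qball_def)
  qed
  thus ?thesis by (metis image_ident sets_measure_of subset_UNIV Pow_UNIV)
qed

lemma q2_measure_eqI:
  assumes "sets M = sets borel" "sets N = sets borel"
    and "\<And>n k. emeasure M (qball n k) = 1 / 2 ^ n" "\<And>n k. emeasure N (qball n k) = 1 / 2 ^ n"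
  shows "M = N"
proof (rule measure_eqI_generator_eq[OF Int_stable_qball])
  show "range (qball 0) \<subseteq> insert {} (range (case_prod qball))" by auto
  show "(\<Union>k. qball 0 k) = UNIV" using qball_cover[of _ 0] by auto
qed (use assms sets_borel_q2 in auto)

lemma measurable_q2_translation [measurable]: "(\<lambda>x. a + x) \<in> borel_measurable (borel :: q2 measure)"
proof (rule borel_measurable_continuous_onI)
  show "continuous_on UNIV (\<lambda>x. a + x)"
    unfolding continuous_on_iff by (auto simp: dist_q2_norm2)
qed

lemma Z2_eq_qball: "Z2 = qball 0 0"
  by (simp add: Z2_def qball_def cball_q2)

lemma ennreal_half_power: "ennreal (1 / 2 ^ n) = 1 / 2 ^ n"
  using divide_ennreal[of 1 "2 ^ n"] ennreal_power[of 2 n] by (simp add: ennreal_1)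

lemma ennreal_halve:
  assumes "2 * x = ennreal r" "r \<ge> 0"
  shows "x = ennreal (r / 2)"
proof (cases x)
  case (real y)
  have "2 * x = ennreal (2 * y)" using real by (simp add: ennreal_mult' flip: ennreal_numeral)
  hence "2 * y = r" using assms real by simp
  thus ?thesis using real by auto
qed (use assms in \<open>auto simp: ennreal_mult_top\<close>)
lemma is_haar2_emeasure_qball:
  assumes "is_haar2 M"
  shows "emeasure M (qball n k) = 1 / 2 ^ n"
proof -
  have sets: "sets M = sets borel" using assms by (simp add: is_haar2_def)
  have trans: "emeasure M (cball a r) = emeasure M (cball 0 r)" for a r
  proof -
    have "cball a r = (\<lambda>x. a + x) ` cball 0 r"
    proof (intro equalityI subsetI)
      fix y assume "y \<in> cball a r"
      thus "y \<in> (\<lambda>x. a + x) ` cball 0 r" by (intro image_eqI[of _ _ "y - a"]) (auto simp: cball_q2)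
    qed (auto simp: cball_q2)
    thus ?thesis using assms by (simp add: is_haar2_def)
  qed
  have "emeasure M (cball 0 (1 / 2 ^ n)) = ennreal (1 / 2 ^ n)" for n
  proof (induction n)
    case 0
    have "cball 0 1 = Z2" by (simp add: Z2_def cball_q2)
    thus ?case using assms by (simp add: is_haar2_def)
  next
    case (Suc n)
    let ?A = "cball (0::q2) (1 / 2 ^ Suc n)" and ?B = "cball (2 ^ n :: q2) (1 / 2 ^ Suc n)"
    have un: "cball (0::q2) (1 / 2 ^ n) = ?A \<union> ?B"
    proof (intro equalityI subsetI)
      fix y :: q2 assume y: "y \<in> cball 0 (1 / 2 ^ n)"
      define u where "u = y / 2 ^ n"
      have yu: "y = 2 ^ n * u" "y - 2 ^ n = 2 ^ n * (u - 1)" by (auto simp: u_def algebra_simps)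
      have u: "norm2 u \<le> 1" using y by (simp add: yu(1) cball_q2 norm2_mult norm2_2_power divide_simps)
      obtain q where q: "norm2 (u - of_rat q) < 1 / 2" using q2_rat_dense[of "1/2" u] by auto
      have "abs2 q \<le> 1"
        using norm2_diff[of u "u - of_rat q"] u q by (simp add: norm2_of_rat)
      hence "abs2 q \<le> 1 / 2 \<or> abs2 (q - 1) \<le> 1 / 2" by (rule abs2_le_1_cases)
      moreover have "norm2 u \<le> max (norm2 (u - of_rat q)) (abs2 q)"
        using norm2_add[of "u - of_rat q" "of_rat q"] by (simp add: norm2_of_rat)
      moreover have "norm2 (u - 1) \<le> max (norm2 (u - of_rat q)) (abs2 (q - 1))"
        using norm2_add[of "u - of_rat q" "of_rat (q - 1)"]
        by (simp add: norm2_of_rat[symmetric] of_rat_diff)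
      ultimately have "norm2 u \<le> 1 / 2 \<or> norm2 (u - 1) \<le> 1 / 2" using q by linarith
      thus "y \<in> ?A \<union> ?B"
        using yu(2) by (auto simp: yu(1) cball_q2 norm2_mult norm2_2_power divide_simps)
    next
      fix y :: q2 assume y: "y \<in> ?A \<union> ?B"
      have "norm2 y \<le> max (norm2 (y - 2 ^ n)) (norm2 (2 ^ n :: q2))" using norm2_add[of "y - 2 ^ n" "2 ^ n"] by simp
      moreover have "1 / 2 ^ Suc n \<le> (1 / 2 ^ n :: real)" by (simp add: field_simps)
      ultimately show "y \<in> cball 0 (1 / 2 ^ n)" using y by (auto simp: cball_q2 norm2_2_power)
    qed
    have "?A \<inter> ?B = {}"
    proof (rule ccontr)
      assume "?A \<inter> ?B \<noteq> {}"
      then obtain y where y: "norm2 y \<le> 1 / 2 ^ Suc n" "norm2 (y - 2 ^ n) \<le> 1 / 2 ^ Suc n"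
        by (auto simp: cball_q2)
      have "norm2 (2 ^ n) \<le> 1 / 2 ^ Suc n" using norm2_diff[of y "y - 2 ^ n"] y by simp
      thus False by (simp add: norm2_2_power field_simps)
    qed
    hence "emeasure M (cball 0 (1 / 2 ^ n)) = emeasure M ?A + emeasure M ?B"
      unfolding un by (intro plus_emeasure[symmetric]) (auto simp: sets)
    also have "\<dots> = 2 * emeasure M ?A" by (simp only: trans[of "2 ^ n"] mult_2)
    finally have eq: "2 * emeasure M ?A = ennreal (1 / 2 ^ n)" using Suc.IH by (simp only:)
    show ?case using ennreal_halve[OF eq] by (simp add: mult.commute)
  qed
  thus ?thesis
    by (simp only: qball_def trans[of "2 ^ n * of_rat (bitrev k)"] ennreal_half_power)
qed

text \<open>Existence: push Lebesgue measure on the half line forward along the map that mirrors binary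
  digits at the binary point.\<close>

definition mirror_seq :: "real \<Rightarrow> nat \<Rightarrow> rat" where
  "mirror_seq t n = 2 ^ n * bitrev (nat \<lfloor>2 ^ n * t\<rfloor>)"

lemma mirror_seq_diff: "t \<ge> 0 \<Longrightarrow> abs2 (mirror_seq t (n + k) - mirror_seq t n) \<le> 1 / 2 ^ n"
proof (induction k)
  case (Suc k)
  define m where "m = n + k"
  define j where "j = nat \<lfloor>2 ^ Suc m * t\<rfloor>"
  have "\<lfloor>2 ^ m * t\<rfloor> = \<lfloor>2 ^ Suc m * t / 2\<rfloor>" by simp
  also have "\<dots> = \<lfloor>2 ^ Suc m * t\<rfloor> div 2" using floor_divide_real_eq_div[of 2 "2 ^ Suc m * t"] by simp
  finally have "nat \<lfloor>2 ^ m * t\<rfloor> = j div 2" by (simp add: j_def nat_div_distrib')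
  hence "mirror_seq t (Suc m) - mirror_seq t m = 2 ^ m * (2 * bitrev j - bitrev (j div 2))"
    by (simp add: mirror_seq_def j_def algebra_simps)
  also have "\<dots> = 2 ^ m * of_int (int (j mod 2))" using bitrev_double[of j] by simp
  finally have "abs2 (mirror_seq t (Suc m) - mirror_seq t m) \<le> 1 / 2 ^ m"
    using abs2_of_int_le_1[of "int (j mod 2)"]
    by (simp add: abs2_mult abs2_power abs2_2 power_one_over divide_simps)
  also have "\<dots> \<le> 1 / 2 ^ n" by (simp add: m_def field_simps)
  finally have 1: "abs2 (mirror_seq t (Suc m) - mirror_seq t m) \<le> 1 / 2 ^ n" .
  have "abs2 ((mirror_seq t (Suc m) - mirror_seq t m) + (mirror_seq t m - mirror_seq t n)) \<le> 1 / 2 ^ n"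
    by (rule order_trans[OF abs2_add]) (use 1 Suc in \<open>auto simp: m_def\<close>)
  thus ?case by (simp add: m_def)
qed simp

lemma cauchy2_mirror_seq:
  assumes "t \<ge> 0"
  shows "cauchy2 (mirror_seq t)"
  unfolding cauchy2_def
proof (intro allI impI)
  fix e :: real assume e: "e > 0"
  obtain N where N: "(1 / 2) ^ N < e" using real_arch_pow_inv[of e "1 / 2"] e by auto
  have "abs2 (mirror_seq t m - mirror_seq t n) < e" if "m \<ge> N" "n \<ge> N" for m n
  proof -
    have "abs2 ((mirror_seq t m - mirror_seq t N) - (mirror_seq t n - mirror_seq t N)) \<le> 1 / 2 ^ N"
      by (rule order_trans[OF abs2_diff])
        (use mirror_seq_diff[OF assms, of N "m - N"] mirror_seq_diff[OF assms, of N "n - N"] that in auto)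
    thus ?thesis using N by (simp add: power_one_over)
  qed
  thus "\<exists>N. \<forall>m\<ge>N. \<forall>n\<ge>N. abs2 (mirror_seq t m - mirror_seq t n) < e" by blast
qed

definition mirror :: "real \<Rightarrow> q2" where
  "mirror t = Q2 (mirror_seq t)"

lemma norm2_mirror_diff:
  assumes "t \<ge> 0"
  shows "norm2 (mirror t - of_rat (mirror_seq t n)) \<le> 1 / 2 ^ n"
proof -
  have c: "cauchy2 (\<lambda>k. mirror_seq t k - mirror_seq t n)"
    using cauchy2_add[OF cauchy2_mirror_seq[OF assms] cauchy2_const[of "- mirror_seq t n"]] by simp
  have "(\<lambda>k. abs2 (mirror_seq t k - mirror_seq t n)) \<longlonglongrightarrow> norm2 (mirror t - of_rat (mirror_seq t n))"
    unfolding of_rat_q2 mirror_def using norm2_Q2[OF c] cauchy2_mirror_seq[OF assms] by (simp add: Q2_diff)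
  thus ?thesis
  proof (rule LIMSEQ_le_const2)
    show "\<exists>N. \<forall>k\<ge>N. abs2 (mirror_seq t k - mirror_seq t n) \<le> 1 / 2 ^ n"
      using mirror_seq_diff[OF assms, of n] by (intro exI[of _ n]) (auto simp: le_iff_add)
  qed
qed

lemma mirror_in_qball_iff:
  assumes "t \<ge> 0"
  shows "mirror t \<in> qball n k \<longleftrightarrow> real k \<le> 2 ^ n * t \<and> 2 ^ n * t < real k + 1"
proof -
  have "mirror t \<in> qball n (nat \<lfloor>2 ^ n * t\<rfloor>)"
    using norm2_mirror_diff[OF assms, of n]
    by (simp add: qball_def cball_q2 mirror_seq_def of_rat_mult of_rat_power)
  hence "mirror t \<in> qball n k \<longleftrightarrow> nat \<lfloor>2 ^ n * t\<rfloor> = k" using qball_unique by blast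
  also have "\<dots> \<longleftrightarrow> \<lfloor>2 ^ n * t\<rfloor> = int k" using assms by (auto simp: nat_eq_iff)
  also have "\<dots> \<longleftrightarrow> real k \<le> 2 ^ n * t \<and> 2 ^ n * t < real k + 1" by (auto simp: floor_eq_iff)
  finally show ?thesis .
qed

lemma measurable_mirror [measurable]: "mirror \<in> restrict_space lborel {0..} \<rightarrow>\<^sub>M borel"
proof (rule borel_measurable_LIMSEQ_metric)
  fix n
  have "(\<lambda>t::real. nat \<lfloor>2 ^ n * t\<rfloor>) \<in> restrict_space lborel {0..} \<rightarrow>\<^sub>M count_space (UNIV :: nat set)"
    by (intro measurable_restrict_space1) measurable
  moreover have "(\<lambda>j. of_rat (2 ^ n * bitrev j) :: q2) \<in> count_space UNIV \<rightarrow>\<^sub>M borel" by simp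
  ultimately show "(\<lambda>t. of_rat (mirror_seq t n) :: q2) \<in> borel_measurable (restrict_space lborel {0..})"
    unfolding mirror_seq_def by (rule measurable_compose)
next
  fix t :: real assume "t \<in> space (restrict_space lborel {0..})"
  hence t: "t \<ge> 0" by (simp add: space_restrict_space)
  show "(\<lambda>n. of_rat (mirror_seq t n)) \<longlonglongrightarrow> mirror t"
  proof (rule metric_LIMSEQ_I)
    fix e :: real assume e: "e > 0"
    obtain N where N: "(1 / 2) ^ N < e" using real_arch_pow_inv[of e "1 / 2"] e by auto
    have "dist (of_rat (mirror_seq t n)) (mirror t) < e" if "n \<ge> N" for n
    proof -
      have "(1 / 2) ^ n \<le> (1 / 2 :: real) ^ N" using that by (intro power_decreasing) auto
      thus ?thesis using norm2_mirror_diff[OF t, of n] N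
        by (simp add: dist_q2_norm2 norm2_minus_commute power_one_over)
    qed
    thus "\<exists>N. \<forall>n\<ge>N. dist (of_rat (mirror_seq t n)) (mirror t) < e" by blast
  qed
qed

definition mirror_measure :: "q2 measure" where
  "mirror_measure = distr (restrict_space lborel {0..}) borel mirror"

lemma sets_mirror_measure [simp, measurable_cong]: "sets mirror_measure = sets borel"
  by (simp add: mirror_measure_def)

lemma emeasure_mirror_measure_qball: "emeasure mirror_measure (qball n k) = 1 / 2 ^ n"
proof -
  have "emeasure mirror_measure (qball n k)
      = emeasure (restrict_space lborel {0..}) (mirror -` qball n k \<inter> {0..})"
    unfolding mirror_measure_def
    by (subst emeasure_distr) (auto simp: qball_def space_restrict_space)
  also have "mirror -` qball n k \<inter> {0..} = {real k / 2 ^ n ..< (real k + 1) / 2 ^ n}"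
  proof -
    have "t \<ge> 0" if "real k / 2 ^ n \<le> t" for t
      using that by (rule order_trans[rotated]) simp
    thus ?thesis by (auto simp: mirror_in_qball_iff field_simps)
  qed
  also have "emeasure (restrict_space lborel {0..}) \<dots> = emeasure lborel {real k / 2 ^ n ..< (real k + 1) / 2 ^ n}"
    by (rule emeasure_restrict_space) (auto intro: order_trans[rotated])
  also have "\<dots> = ennreal (1 / 2 ^ n)"
    by (subst emeasure_lborel_Ico) (auto simp: field_simps)
  also have "\<dots> = 1 / 2 ^ n" by (rule ennreal_half_power)
  finally show ?thesis .
qed

lemma is_haar2_mirror_measure: "is_haar2 mirror_measure"
  unfolding is_haar2_def
proof (intro conjI allI ballI)
  show "emeasure mirror_measure Z2 = 1"
    unfolding Z2_eq_qball emeasure_mirror_measure_qball by simp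
next
  fix a :: q2 and A :: "q2 set" assume A: "A \<in> sets borel"
  have [simp]: "space mirror_measure = UNIV" using sets_eq_imp_space_eq[OF sets_mirror_measure] by simp
  have "distr mirror_measure borel (\<lambda>x. - a + x) = mirror_measure"
  proof (rule q2_measure_eqI)
    fix n k
    obtain l where l: "cball (a + 2 ^ n * of_rat (bitrev k)) (1 / 2 ^ n) = qball n l"
      using cball_q2_qball by blast
    have "(\<lambda>x. - a + x) -` qball n k = cball (a + 2 ^ n * of_rat (bitrev k)) (1 / 2 ^ n)"
      by (auto simp: qball_def cball_q2 algebra_simps)
    hence "(+) (- a) -` qball n k = qball n l" using l by (simp only:)
    thus "emeasure (distr mirror_measure borel (\<lambda>x. - a + x)) (qball n k) = 1 / 2 ^ n"
      using emeasure_mirror_measure_qball[of n l] by (subst emeasure_distr) (auto simp: qball_borel)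
  qed (auto simp: emeasure_mirror_measure_qball)
  hence "emeasure mirror_measure A = emeasure (distr mirror_measure borel (\<lambda>x. - a + x)) A" by simp
  also have "\<dots> = emeasure mirror_measure ((\<lambda>x. - a + x) -` A)"
    using A by (subst emeasure_distr) auto
  also have "(\<lambda>x. - a + x) -` A = (\<lambda>x. a + x) ` A"
    by (force simp: image_iff)
  finally show "emeasure mirror_measure ((\<lambda>x. a + x) ` A) = emeasure mirror_measure A" by simp
qed simp

lemma ex1_haar2: "\<exists>!M. is_haar2 M"
proof (rule ex1I[where a = mirror_measure])
  show "is_haar2 mirror_measure" by (rule is_haar2_mirror_measure)
next
  fix M assume "is_haar2 M"
  thus "M = mirror_measure"
    by (intro q2_measure_eqI is_haar2_emeasure_qball emeasure_mirror_measure_qball)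
      (auto simp: is_haar2_def)
qed

lemma is_haar2_haar2: "is_haar2 haar2"
  unfolding haar2_def by (rule theI'[OF ex1_haar2])

section \<open>Square-integrable functions\<close>

text \<open>Elements of the space \<open>L2\<close> are represented by functions; every subspace below is an
  \<open>L2\<close>-closure or an orthogonal complement and so is closed under equality almost everywhere.\<close>

definition L2 :: "(q2 \<Rightarrow> complex) set" where
  "L2 = {f. f \<in> borel_measurable haar2 \<and> integrable haar2 (\<lambda>x. (cmod (f x))\<^sup>2)}"

definition l2_inner :: "(q2 \<Rightarrow> complex) \<Rightarrow> (q2 \<Rightarrow> complex) \<Rightarrow> complex" where
  "l2_inner f g = (LINT x|haar2. f x * cnj (g x))"

definition l2_norm :: "(q2 \<Rightarrow> complex) \<Rightarrow> real" where
  "l2_norm f = sqrt (LINT x|haar2. (cmod (f x))\<^sup>2)"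

definition cspan :: "(q2 \<Rightarrow> complex) set \<Rightarrow> (q2 \<Rightarrow> complex) set" where
  "cspan S = {(\<lambda>x. \<Sum>f\<in>F. c f * f x) | F c. finite F \<and> F \<subseteq> S}"

definition l2_closure :: "(q2 \<Rightarrow> complex) set \<Rightarrow> (q2 \<Rightarrow> complex) set" where
  "l2_closure S = {f \<in> L2. \<forall>e>0. \<exists>g\<in>S \<inter> L2. l2_norm (\<lambda>x. f x - g x) < e}"

text \<open>Orthonormality refers to the indexed family: members with different indices are orthogonal.\<close>

definition is_orthonormal_basis :: "'i set \<Rightarrow> ('i \<Rightarrow> q2 \<Rightarrow> complex) \<Rightarrow> (q2 \<Rightarrow> complex) set \<Rightarrow> bool" where
  "is_orthonormal_basis I u W \<longleftrightarrow> (\<forall>i\<in>I. u i \<in> W) \<and>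
     (\<forall>i\<in>I. \<forall>j\<in>I. l2_inner (u i) (u j) = (if i = j then 1 else 0)) \<and>
     l2_closure (cspan (u ` I)) = W"

section \<open>The 2-adic Haar multiresolution analysis\<close>

definition I2 :: "q2 set" where
  "I2 = {(\<Sum>j<g. of_nat (a j) * 2 ^ j) / 2 ^ g | (g::nat) (a::nat \<Rightarrow> nat). g \<ge> 1 \<and> (\<forall>j<g. a j \<in> {0, 1})}"

definition haar_scaling :: "q2 \<Rightarrow> complex" where
  "haar_scaling = indicator Z2"

definition haar_V :: "int \<Rightarrow> (q2 \<Rightarrow> complex) set" where
  "haar_V j = l2_closure (cspan ((\<lambda>a x. haar_scaling (2 powi (- j) * x - a)) ` I2))"

definition haar_W0 :: "(q2 \<Rightarrow> complex) set" where
  "haar_W0 = {f \<in> haar_V 1. \<forall>g\<in>haar_V 0. l2_inner f g = 0}"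

definition haar_psi0 :: "q2 \<Rightarrow> complex" where
  "haar_psi0 x = haar_scaling (x / 2) - haar_scaling (x / 2 - 1 / 2)"

definition is_haar_wavelet :: "(q2 \<Rightarrow> complex) \<Rightarrow> bool" where
  "is_haar_wavelet \<psi> \<longleftrightarrow> \<psi> \<in> haar_W0 \<and> is_orthonormal_basis I2 (\<lambda>a x. \<psi> (x - a)) haar_W0"

end

(* The translation U by 1 / 2^s generates, on the span of the translates of psi0 by multiples of
   1 / 2^s, a cyclic group with U^(2^s) = -1, since psi0 (x - 1) = - psi0 x. Its eigenvalues are
   therefore the 2^s-th roots of -1. With p the polynomial that has coefficients alpha, psi is p(U)
   applied to psi0; its translates are orthonormal, and then also span the same space as those of
   psi0, exactly if p(U) is unitary, that is if the values of p at these roots have absolute value 1.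
   Those values are the gammas, and inverting the discrete Fourier transform expresses alpha by them. *)
theory Submission
  imports Defs "HOL-Library.Real_Mod"
begin

section \<open>Powers of the roots of -1\<close>

text \<open>No operator appears in the formalization. That \<open>p(U)\<close> is unitary is
  expressed by one identity, \<open>sum k l. alpha k * cnj (alpha l) * haar_psi0 (b + k/2^s - l/2^s)
  = haar_psi0 b\<close> for all \<open>b\<close>. It serves twice because \<open>haar_psi0\<close>
  is its own autocorrelation: the inner product of its translates by \<open>b\<close> and
  \<open>c\<close> is \<open>haar_psi0 (b - c)\<close>. Read at a difference of indices, the
  identity gives orthonormality; read as an identity of functions, it recovers psi0 from translates
  of psi and so gives completeness. The obstacle is that \<open>I2\<close> is not closed under
  translation by \<open>1 / 2^s\<close>. Translation by a 2-adic integer only multiplies psi0, and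
  hence psi, by a sign, so the translates over \<open>I2\<close> and over the whole field have the
  same span, and spans are taken over the field. In the converse direction the indices
  \<open>m / 2^s\<close> with \<open>m < 2^s\<close> suffice: the inner products of these translates
  with psi are, up to normalization, the Fourier transform of the squared moduli of the values of
  \<open>p\<close>.\<close>

lemma sum_roots_of_unity_power:
  fixes n :: int and N :: nat
  assumes "N > 0"
  shows "(\<Sum>k<N. cis (2 * pi * of_int n * real k / real N)) = (if int N dvd n then of_nat N else 0)"
proof -
  define z where "z = cis (2 * pi * of_int n / real N)"
  have pow: "cis (2 * pi * of_int n * real k / real N) = z ^ k" for k
    unfolding z_def Complex.DeMoivre by (rule arg_cong[of _ _ cis]) simp
  have z1: "z = 1 \<longleftrightarrow> int N dvd n"
  proof
    assume "z = 1"
    then obtain m where "2 * pi * of_int n / real N = of_int m * (2 * pi)"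
      unfolding z_def cis_eq_1_iff by blast
    hence "of_int n = (of_int (m * int N) :: real)" using assms by (simp add: field_simps)
    hence "n = m * int N" by (simp only: of_int_eq_iff)
    thus "int N dvd n" by simp
  next
    assume "int N dvd n"
    then obtain m where "n = int N * m" by (rule dvdE)
    hence "2 * pi * of_int n / real N = of_int m * (2 * pi)" using assms by simp
    thus "z = 1" unfolding z_def cis_eq_1_iff by blast
  qed
  have zN: "z ^ N = 1"
  proof -
    have "real N * (2 * pi * of_int n / real N) = of_int n * (2 * pi)" using assms by simp
    thus ?thesis unfolding z_def Complex.DeMoivre cis_eq_1_iff by blast
  qed
  show ?thesis
    unfolding pow by (cases "z = 1") (use z1 zN in \<open>auto simp: sum_gp_strict\<close>)
qed

text \<open>The \<open>N\<close>-th roots of \<open>-1\<close>, enumerated by \<open>r\<close> and raised to the power \<open>n\<close>. The summand \<open>N\<close>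
  contributes the sign \<open>(-1)^n\<close> of the theorem; for even \<open>N\<close> it only permutes the roots.\<close>

definition root_pow :: "nat \<Rightarrow> nat \<Rightarrow> int \<Rightarrow> complex" where
  "root_pow N r n = cis (pi * real (2 * r + 1 + N) * of_int n / real N)"

lemma root_pow_add: "root_pow N r (m + n) = root_pow N r m * root_pow N r n"
  by (simp add: root_pow_def cis_mult algebra_simps add_divide_distrib)

lemma root_pow_minus: "root_pow N r (- n) = cnj (root_pow N r n)"
  by (simp add: root_pow_def cis_cnj)

lemma root_pow_0 [simp]: "root_pow N r 0 = 1"
  by (simp add: root_pow_def)

lemma root_pow_eq_exp:
  assumes "N > 0"
  shows "root_pow N r (- int k) = (- 1) ^ k * exp (- \<i> * of_real pi * (of_nat (2 * r + 1) / of_nat N) * of_nat k)"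
proof -
  have "cis (- pi * k) = (- 1) ^ k"
  proof -
    have "cis (- pi) = - 1" by (simp add: complex_eq_iff)
    thus ?thesis using Complex.DeMoivre[of "- pi" k] by (simp add: mult.commute)
  qed
  moreover have "exp (- \<i> * of_real pi * (of_nat (2 * r + 1) / of_nat N) * of_nat k)
      = cis (- pi * real (2 * r + 1) * real k / real N)"
    by (simp add: cis_conv_exp algebra_simps)
  moreover have "pi * real (2 * r + 1 + N) * of_int (- int k) / real N
      = - pi * k + - pi * real (2 * r + 1) * real k / real N"
    using assms by (simp add: field_simps)
  ultimately show ?thesis by (simp only: root_pow_def flip: cis_mult)
qed

text \<open>A phase times a geometric sum of roots of unity. The sum survives only for
  \<open>n = N * q\<close>, where the phase is (-1)^((N+1) q) = (-1)^q because \<open>N\<close> is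
  even.\<close>

lemma sum_root_pow:
  assumes "N > 0" "even N"
  shows "(\<Sum>r<N. root_pow N r n) =
    (if 2 * int N dvd n then of_nat N else 0) - (if 2 * int N dvd n - int N then of_nat N else 0)"
proof -
  have "root_pow N r n = cis (pi * real (N + 1) * of_int n / real N) * cis (2 * pi * of_int n * real r / real N)" for r
    by (simp add: root_pow_def cis_mult algebra_simps add_divide_distrib)
  hence *: "(\<Sum>r<N. root_pow N r n) = cis (pi * real (N + 1) * of_int n / real N) * (if int N dvd n then of_nat N else 0)"
    using sum_roots_of_unity_power[OF assms(1), of n] by (simp flip: sum_distrib_left)
  show ?thesis
  proof (cases "int N dvd n")
    case True
    then obtain q where q: "n = int N * q" by (rule dvdE)
    have d1: "2 * int N dvd n \<longleftrightarrow> even q"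
      using assms(1) dvd_mult_cancel_left[of "int N" 2 q] by (simp add: q mult.commute)
    have "n - int N = int N * (q - 1)" by (simp add: q algebra_simps)
    hence d2: "2 * int N dvd n - int N \<longleftrightarrow> odd q"
      using assms(1) dvd_mult_cancel_left[of "int N" 2 "q - 1"] by (simp add: mult.commute)
    obtain M where M: "N = 2 * M" using assms(2) by (rule evenE)
    have "cis (pi * real (N + 1) * of_int n / real N) = (if even q then 1 else -1)"
    proof -
      have "pi * real (N + 1) * of_int n / real N = of_int (q * int M) * (2 * pi) + pi * of_int q"
        using assms(1) by (simp add: q M field_simps)
      also have "cis \<dots> = cis (pi * of_int q)"
      proof -
        have "cis (of_int (q * int M) * (2 * pi)) = 1" unfolding cis_eq_1_iff by blast
        thus ?thesis by (simp only: mult_1 flip: cis_mult)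
      qed
      also have "\<dots> = (if even q then 1 else - 1)"
      proof (cases "even q")
        case True
        then obtain p where "q = 2 * p" by (rule evenE)
        thus ?thesis by (auto simp: cis_eq_1_iff)
      next
        case False
        then obtain p where "q = 2 * p + 1" by (rule oddE)
        hence "cis (pi * of_int q) = cis (of_int p * (2 * pi)) * cis pi"
          by (simp only: cis_mult) (simp add: algebra_simps)
        moreover have "cis (of_int p * (2 * pi)) = 1" unfolding cis_eq_1_iff by blast
        ultimately show ?thesis using False by simp
      qed
      finally show ?thesis .
    qed
    thus ?thesis using * True d1 d2 by auto
  next
    case False
    have "\<not> 2 * int N dvd n" "\<not> 2 * int N dvd n - int N"
      using False dvd_mult_right[of 2 "int N" n] dvd_mult_right[of 2 "int N" "n - int N"]
      by (auto simp: dvd_diff_left_iff dest: dvd_add[OF _ dvd_refl])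
    thus ?thesis using * False by simp
  qed
qed

text \<open>The offset \<open>1 + N\<close> common to both exponents cancels, which leaves a
  character of the cyclic group of order \<open>N\<close>; it is trivial only for
  \<open>r = r'\<close>, since the two differ by less than \<open>N\<close>.\<close>

lemma root_pow_orthogonal:
  assumes "r < N" "r' < N"
  shows "(\<Sum>k<N. root_pow N r (int k) * root_pow N r' (- int k)) = (if r = r' then of_nat N else 0)"
proof -
  have "root_pow N r (int k) * root_pow N r' (- int k)
      = cis (2 * pi * of_int (int r - int r') * real k / real N)" for k
    unfolding root_pow_def cis_mult by (rule arg_cong[of _ _ cis]) (use assms in \<open>simp add: field_simps\<close>)
  moreover have "int N dvd int r - int r' \<longleftrightarrow> r = r'"
  proof
    assume "int N dvd int r - int r'"
    moreover have "\<not> \<bar>int N\<bar> \<le> \<bar>int r - int r'\<bar>" using assms by linarith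
    ultimately show "r = r'" using dvd_imp_le_int[of "int r - int r'" "int N"] by linarith
  qed simp
  ultimately show ?thesis using sum_roots_of_unity_power[of N "int r - int r'"] assms by simp
qed

text \<open>For even \<open>N\<close>, the value of the polynomial \<open>p\<close> at the root of
  -1 with number \<open>r\<close>, that is, an eigenvalue of \<open>p(U)\<close>.\<close>

definition symbol :: "nat \<Rightarrow> (nat \<Rightarrow> complex) \<Rightarrow> nat \<Rightarrow> complex" where
  "symbol N \<alpha> r = (\<Sum>k<N. \<alpha> k * root_pow N r (int k))"

text \<open>The Kronecker delta adapted to U^N = -1: it changes sign under \<open>n\<close> to
  \<open>n + N\<close>. For \<open>N = 2^s\<close> it is \<open>haar_psi0\<close> on the multiples
  of \<open>1 / 2^s\<close>.\<close>

definition antiperiod :: "nat \<Rightarrow> int \<Rightarrow> complex" where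
  "antiperiod N n = (if 2 * int N dvd n then 1 else 0) - (if 2 * int N dvd n - int N then 1 else 0)"

lemma antiperiod_eq_sum:
  assumes "N > 0" "even N"
  shows "antiperiod N n = (\<Sum>r<N. root_pow N r n) / of_nat N"
  using assms(1) unfolding sum_root_pow[OF assms] antiperiod_def by simp

lemma antiperiod_small: "\<bar>n\<bar> < int N \<Longrightarrow> antiperiod N n = (if n = 0 then 1 else 0)"
proof -
  assume n: "\<bar>n\<bar> < int N"
  have "2 * int N dvd n \<longleftrightarrow> n = 0"
    using n dvd_imp_le_int[of n "2 * int N"] by auto
  moreover have "\<not> 2 * int N dvd n - int N"
  proof
    assume "2 * int N dvd n - int N"
    moreover have "n - int N \<noteq> 0" using n by linarith
    ultimately have "\<bar>2 * int N\<bar> \<le> \<bar>n - int N\<bar>" by (intro dvd_imp_le_int)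
    thus False using n by linarith
  qed
  ultimately show ?thesis by (simp add: antiperiod_def)
qed

text \<open>Once \<open>antiperiod\<close> is expanded in the roots of -1, the sums over
  \<open>k\<close> and \<open>l\<close> separate for each root into the symbol and its
  conjugate.\<close>

lemma autocorrelation_eq:
  assumes "N > 0" "even N"
  shows "(\<Sum>k<N. \<Sum>l<N. \<alpha> k * cnj (\<alpha> l) * antiperiod N (m + int k - int l))
    = (\<Sum>r<N. root_pow N r m * of_real ((cmod (symbol N \<alpha> r))\<^sup>2)) / of_nat N"
proof -
  have "(\<Sum>k<N. \<Sum>l<N. \<alpha> k * cnj (\<alpha> l) * antiperiod N (m + int k - int l))
    = (\<Sum>k<N. \<Sum>l<N. \<Sum>r<N. \<alpha> k * cnj (\<alpha> l) * root_pow N r (m + int k + - int l)) / of_nat N"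
    by (simp add: antiperiod_eq_sum[OF assms] sum_divide_distrib sum_distrib_left)
  also have "(\<Sum>k<N. \<Sum>l<N. \<Sum>r<N. \<alpha> k * cnj (\<alpha> l) * root_pow N r (m + int k + - int l))
    = (\<Sum>k<N. \<Sum>r<N. \<Sum>l<N. \<alpha> k * cnj (\<alpha> l) * root_pow N r (m + int k + - int l))"
    by (rule sum.cong[OF refl], rule sum.swap)
  also have "\<dots> = (\<Sum>r<N. \<Sum>k<N. \<Sum>l<N. \<alpha> k * cnj (\<alpha> l) * root_pow N r (m + int k + - int l))"
    by (rule sum.swap)
  also have "\<dots> = (\<Sum>r<N. root_pow N r m * of_real ((cmod (symbol N \<alpha> r))\<^sup>2))"
  proof (rule sum.cong[OF refl])
    fix r
    have "root_pow N r m * of_real ((cmod (symbol N \<alpha> r))\<^sup>2)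
       = root_pow N r m * ((\<Sum>k<N. \<alpha> k * root_pow N r (int k)) * (\<Sum>l<N. cnj (\<alpha> l) * root_pow N r (- int l)))"
      by (simp only: complex_norm_square symbol_def cnj_sum complex_cnj_mult root_pow_minus)
    also have "\<dots> = (\<Sum>k<N. \<Sum>l<N. \<alpha> k * cnj (\<alpha> l) * root_pow N r (m + int k + - int l))"
      unfolding sum_product unfolding sum_distrib_left root_pow_add by (intro sum.cong refl) (simp only: mult_ac)
    finally show "(\<Sum>k<N. \<Sum>l<N. \<alpha> k * cnj (\<alpha> l) * root_pow N r (m + int k + - int l))
      = root_pow N r m * of_real ((cmod (symbol N \<alpha> r))\<^sup>2)" ..
  qed
  finally show ?thesis .
qed

lemma autocorrelation_unimodular:
  assumes "N > 0" "even N" "\<And>r. r < N \<Longrightarrow> cmod (symbol N \<alpha> r) = 1"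
  shows "(\<Sum>k<N. \<Sum>l<N. \<alpha> k * cnj (\<alpha> l) * antiperiod N (m + int k - int l)) = antiperiod N m"
  unfolding autocorrelation_eq[OF assms(1,2)] using assms(3) by (simp add: antiperiod_eq_sum[OF assms(1,2)])

text \<open>The \<open>N\<close> hypotheses prescribe the Fourier transform of the \<open>N\<close>
  numbers \<open>(cmod (symbol N \<alpha> r))\<^sup>2\<close>. Inverting it by
  \<open>root_pow_orthogonal\<close>, only \<open>m = 0\<close> contributes, and every one of these
  numbers is 1.\<close>

lemma unimodular_symbol:
  assumes "N > 0" "even N" "r < N"
    and "\<And>m. m < N \<Longrightarrow> (\<Sum>k<N. \<Sum>l<N. \<alpha> k * cnj (\<alpha> l) * antiperiod N (int m + int k - int l))
      = (if m = 0 then 1 else 0)"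
  shows "cmod (symbol N \<alpha> r) = 1"
proof -
  define w where "w = (\<lambda>r. complex_of_real ((cmod (symbol N \<alpha> r))\<^sup>2))"
  have G: "(\<Sum>r'<N. root_pow N r' (int m) * w r') = (if m = 0 then of_nat N else 0)" if "m < N" for m
    using assms(4)[OF that] assms(1) unfolding autocorrelation_eq[OF assms(1,2)] w_def
    by (auto simp: field_simps split: if_splits)
  have "of_nat N = (\<Sum>m<N. (if m = 0 then of_nat N else 0) * root_pow N r (- int m))"
    using assms(1) by (simp add: if_distrib[of "\<lambda>x. x * _"] cong: if_cong)
  also have "\<dots> = (\<Sum>m<N. (\<Sum>r'<N. root_pow N r' (int m) * w r') * root_pow N r (- int m))"
    by (intro sum.cong refl) (simp add: G)
  also have "\<dots> = (\<Sum>r'<N. \<Sum>m<N. w r' * (root_pow N r' (int m) * root_pow N r (- int m)))"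
    unfolding sum_distrib_right by (subst sum.swap) (simp only: mult_ac)
  also have "\<dots> = (\<Sum>r'<N. w r' * (if r' = r then of_nat N else 0))"
    unfolding sum_distrib_left[symmetric] using assms(3) by (intro sum.cong refl) (simp add: root_pow_orthogonal)
  also have "\<dots> = w r * of_nat N"
    using assms(3) by (simp add: if_distrib[of "\<lambda>x. _ * x"] cong: if_cong)
  finally have "w r = 1" using assms(1) by simp
  hence "(cmod (symbol N \<alpha> r))\<^sup>2 = 1\<^sup>2" by (simp only: w_def of_real_eq_1_iff power_one)
  thus ?thesis by (subst (asm) power2_eq_iff_nonneg) auto
qed

text \<open>Coefficients and symbol are a transform pair, so the only possible
  \<open>\<gamma>\<close> is the symbol itself. One direction uses orthogonality of the sums over
  \<open>k\<close>, the other that of the sums over \<open>r\<close>.\<close>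

lemma symbol_inversion:
  assumes "N > 0" "even N"
  shows "(\<exists>\<gamma>. (\<forall>r<N. cmod (\<gamma> r) = 1) \<and> (\<forall>k<N. \<alpha> k = (\<Sum>r<N. \<gamma> r * root_pow N r (- int k)) / of_nat N))
    \<longleftrightarrow> (\<forall>r<N. cmod (symbol N \<alpha> r) = 1)"
proof (intro iffI allI impI)
  fix r assume r: "r < N"
  assume "\<exists>\<gamma>. (\<forall>r<N. cmod (\<gamma> r) = 1) \<and> (\<forall>k<N. \<alpha> k = (\<Sum>r<N. \<gamma> r * root_pow N r (- int k)) / of_nat N)"
  then obtain \<gamma> where \<gamma>: "\<forall>r<N. cmod (\<gamma> r) = 1"
    "\<And>k. k < N \<Longrightarrow> \<alpha> k = (\<Sum>r<N. \<gamma> r * root_pow N r (- int k)) / of_nat N" by blast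
  have "symbol N \<alpha> r = (\<Sum>k<N. (\<Sum>r'<N. \<gamma> r' * root_pow N r' (- int k)) / of_nat N * root_pow N r (int k))"
    unfolding symbol_def by (intro sum.cong refl) (simp add: \<gamma>)
  also have "\<dots> = (\<Sum>r'<N. \<Sum>k<N. \<gamma> r' * (root_pow N r (int k) * root_pow N r' (- int k))) / of_nat N"
    unfolding sum_distrib_right sum_divide_distrib by (subst sum.swap) (simp add: mult_ac)
  also have "\<dots> = (\<Sum>r'<N. \<gamma> r' * (if r = r' then of_nat N else 0)) / of_nat N"
    unfolding sum_distrib_left[symmetric] using r by (simp add: root_pow_orthogonal)
  also have "\<dots> = \<gamma> r"
    using r by (simp add: if_distrib[of "\<lambda>x. _ * x"] cong: if_cong)
  finally show "cmod (symbol N \<alpha> r) = 1" using \<gamma>(1) r by simp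
next
  assume 1: "\<forall>r<N. cmod (symbol N \<alpha> r) = 1"
  have "\<alpha> k = (\<Sum>r<N. symbol N \<alpha> r * root_pow N r (- int k)) / of_nat N" if k: "k < N" for k
  proof -
    have "(\<Sum>r<N. symbol N \<alpha> r * root_pow N r (- int k)) / of_nat N
        = (\<Sum>r<N. \<Sum>l<N. \<alpha> l * root_pow N r (int l + - int k)) / of_nat N"
      by (simp only: symbol_def sum_distrib_right root_pow_add mult.assoc)
    also have "\<dots> = (\<Sum>l<N. \<alpha> l * antiperiod N (int l + - int k))"
      unfolding antiperiod_eq_sum[OF assms] by (subst sum.swap) (simp add: sum_distrib_left sum_divide_distrib)
    also have "\<dots> = (\<Sum>l<N. \<alpha> l * (if l = k then 1 else 0))"
      using k by (intro sum.cong refl) (auto simp: antiperiod_small)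
    also have "\<dots> = \<alpha> k" using k by (simp add: if_distrib[of "\<lambda>x. _ * x"] cong: if_cong)
    finally show ?thesis ..
  qed
  thus "\<exists>\<gamma>. (\<forall>r<N. cmod (\<gamma> r) = 1) \<and> (\<forall>k<N. \<alpha> k = (\<Sum>r<N. \<gamma> r * root_pow N r (- int k)) / of_nat N)"
    using 1 by blast
qed

section \<open>Arithmetic of the 2-adic numbers\<close>

lemma norm2_1 [simp]: "norm2 1 = 1"
  using norm2_of_rat[of 1] by simp

lemma norm2_inverse: "norm2 (inverse x) = inverse (norm2 x)"
proof (cases "x = 0")
  case False
  hence "norm2 (inverse x) * norm2 x = 1" by (simp flip: norm2_mult)
  thus ?thesis by (metis inverse_unique mult.commute)
qed simp

lemma norm2_divide: "norm2 (x / y) = norm2 x / norm2 y"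
  by (simp add: divide_inverse norm2_mult norm2_inverse)

lemma norm2_of_int_le_1: "norm2 (of_int n) \<le> 1"
  using norm2_of_rat[of "of_int n"] abs2_of_int_le_1[of n] by simp

lemma norm2_of_int_le_iff: "norm2 (of_int n) \<le> 1 / 2 ^ k \<longleftrightarrow> 2 ^ k dvd n"
proof (cases "n = 0")
  case False
  have "norm2 (of_int n) = 1 / 2 ^ multiplicity 2 n"
    using norm2_of_rat[of "of_int n"] abs2_divide_of_int[of n 1] False
    by (simp add: power_int_minus power_int_def field_simps)
  also have "\<dots> \<le> 1 / 2 ^ k \<longleftrightarrow> k \<le> multiplicity 2 n"
    by (simp add: divide_simps)
  also have "\<dots> \<longleftrightarrow> 2 ^ k dvd n"
    using False by (subst power_dvd_iff_le_multiplicity) auto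
  finally show ?thesis .
qed simp

text \<open>The residue field has two elements; density of the rationals transfers this from
  \<open>abs2_le_1_cases\<close>.\<close>

lemma norm2_le_1_cases:
  assumes "norm2 u \<le> 1"
  shows "norm2 u \<le> 1 / 2 \<or> norm2 (u - 1) \<le> 1 / 2"
proof -
  obtain q where q: "norm2 (u - of_rat q) < 1 / 2" using q2_rat_dense[of "1/2" u] by auto
  have "abs2 q \<le> 1" using norm2_diff[of u "u - of_rat q"] assms q by (simp add: norm2_of_rat)
  hence "abs2 q \<le> 1 / 2 \<or> abs2 (q - 1) \<le> 1 / 2" by (rule abs2_le_1_cases)
  moreover have "norm2 u \<le> max (norm2 (u - of_rat q)) (abs2 q)"
    using norm2_add[of "u - of_rat q" "of_rat q"] by (simp add: norm2_of_rat)
  moreover have "norm2 (u - 1) \<le> max (norm2 (u - of_rat q)) (abs2 (q - 1))"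
    using norm2_add[of "u - of_rat q" "of_rat (q - 1)"]
    by (simp add: norm2_of_rat[symmetric] of_rat_diff)
  ultimately show ?thesis using q by linarith
qed

text \<open>Each induction step finds one binary digit of \<open>u\<close>: the residue of the
  scaled remainder \<open>v\<close> decides whether \<open>2^k\<close> is added to
  \<open>m\<close>.\<close>

lemma of_nat_dense_Z2:
  assumes "norm2 u \<le> 1"
  shows "\<exists>m. norm2 (u - of_nat m) \<le> 1 / 2 ^ k"
proof (induction k)
  case 0
  thus ?case using assms by (intro exI[of _ 0]) simp
next
  case (Suc k)
  then obtain m where m: "norm2 (u - of_nat m) \<le> 1 / 2 ^ k" by blast
  define v where "v = (u - of_nat m) / 2 ^ k"
  have v: "u - of_nat m = 2 ^ k * v" "u - of_nat (m + 2 ^ k) = 2 ^ k * (v - 1)"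
    by (simp_all add: v_def field_simps)
  have "norm2 v \<le> 1" using m by (simp add: v_def norm2_divide norm2_2_power field_simps)
  hence "norm2 v \<le> 1 / 2 \<or> norm2 (v - 1) \<le> 1 / 2" by (rule norm2_le_1_cases)
  hence "norm2 (u - of_nat m) \<le> 1 / 2 ^ Suc k \<or> norm2 (u - of_nat (m + 2 ^ k)) \<le> 1 / 2 ^ Suc k"
    unfolding v norm2_mult norm2_2_power by (simp add: field_simps)
  thus ?case by blast
qed

section \<open>Representatives of Q_2 modulo Z_2\<close>

lemma I2_eq: "I2 = {of_nat m / 2 ^ g | m g. m < 2 ^ g}"
proof (intro equalityI subsetI)
  fix x assume "x \<in> I2"
  then obtain g a where x: "x = (\<Sum>j<g. of_nat (a j) * 2 ^ j) / 2 ^ g" and a: "\<And>j. j < g \<Longrightarrow> a j \<in> {0, 1}"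
    by (auto simp: I2_def)
  have "(\<Sum>j<g. a j * 2 ^ j) < 2 ^ g" using a
  proof (induction g)
    case (Suc g)
    hence "(\<Sum>j<g. a j * 2 ^ j) < 2 ^ g" "a g \<le> 1" by force+
    thus ?case by (cases "a g") auto
  qed simp
  moreover have "x = of_nat (\<Sum>j<g. a j * 2 ^ j) / 2 ^ g" by (simp add: x)
  ultimately show "x \<in> {of_nat m / 2 ^ g | m g. m < 2 ^ g}" by blast
next
  fix x :: q2 assume "x \<in> {of_nat m / 2 ^ g | m g. m < 2 ^ g}"
  then obtain m g where x: "x = of_nat m / 2 ^ g" and m: "m < 2 ^ g" by blast
  \<comment> \<open>\<open>I2\<close> asks for at least one digit, whereas \<open>g = 0\<close> is
    possible here. Doubling numerator and denominator makes the number of digits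
    \<open>Suc g\<close>.\<close>
  have "2 * m = take_bit (Suc g) (2 * m)" using m by (intro take_bit_nat_eq_self[symmetric]) simp
  also have "\<dots> = (\<Sum>j<Suc g. of_bool (bit (2 * m) j) * 2 ^ j)"
    by (simp add: take_bit_sum push_bit_eq_mult atLeast0LessThan del: sum.lessThan_Suc)
  finally have "of_nat (2 * m) = (\<Sum>j<Suc g. of_nat (of_bool (bit (2 * m) j)) * 2 ^ j :: q2)"
    by (metis (no_types, lifting) of_nat_mult of_nat_numeral of_nat_power of_nat_sum sum.cong)
  moreover have "x = of_nat (2 * m) / 2 ^ Suc g" by (simp add: x)
  ultimately have "x = (\<Sum>j<Suc g. of_nat (of_bool (bit (2 * m) j)) * 2 ^ j) / 2 ^ Suc g"
    by (simp only:)
  thus "x \<in> I2" unfolding I2_def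
    by (intro CollectI exI[of _ "Suc g"] exI[of _ "\<lambda>j. of_bool (bit (2 * m) j)"]) auto
qed

text \<open>Scaled into Z2, \<open>b\<close> is approximated by a natural number \<open>m\<close>.
  Reducing \<open>m\<close> modulo \<open>2^g\<close> changes \<open>m / 2^g\<close> by an integer
  only, which has norm at most 1.\<close>

lemma I2_representative: "\<exists>a\<in>I2. norm2 (b - a) \<le> 1"
proof -
  obtain g where g: "norm2 b < 2 ^ g" using real_arch_pow[of 2 "norm2 b"] by auto
  have "norm2 (2 ^ g * b) \<le> 1" using g by (simp add: norm2_mult norm2_2_power)
  then obtain m where m: "norm2 (2 ^ g * b - of_nat m) \<le> 1 / 2 ^ g" using of_nat_dense_Z2 by blast
  define a :: q2 where "a = of_nat (m mod 2 ^ g) / 2 ^ g"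
  have "2 ^ g * b - of_nat m = 2 ^ g * (b - of_nat m / 2 ^ g)" by (simp add: field_simps)
  hence "norm2 (2 ^ g * b - of_nat m) = norm2 (b - of_nat m / 2 ^ g) / 2 ^ g"
    by (simp only: norm2_mult norm2_2_power) simp
  hence 1: "norm2 (b - of_nat m / 2 ^ g) \<le> 1" using m by (simp add: divide_le_cancel)
  have "of_nat m = (of_nat (m mod 2 ^ g + 2 ^ g * (m div 2 ^ g)) :: q2)" by simp
  also have "\<dots> = of_nat (m mod 2 ^ g) + 2 ^ g * of_int (int (m div 2 ^ g))"
    unfolding of_nat_add of_nat_mult by simp
  finally have "b - a = (b - of_nat m / 2 ^ g) + of_int (int (m div 2 ^ g))"
    by (simp add: a_def field_simps)
  hence "norm2 (b - a) \<le> 1" using 1 norm2_of_int_le_1[of "int (m div 2 ^ g)"] norm2_add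
    by (metis dual_order.trans max.bounded_iff)
  moreover have "a \<in> I2" unfolding I2_eq a_def 
    by (intro CollectI exI[of _ "m mod 2 ^ g"] exI[of _ g] conjI refl mod_less_divisor) simp
  ultimately show ?thesis by blast
qed

text \<open>Over the common denominator \<open>2^(g + h)\<close> the numerator of the difference is
  divisible by \<open>2^(g + h)\<close> and smaller than it in absolute value.\<close>

lemma I2_unique:
  assumes "a \<in> I2" "b \<in> I2" "norm2 (a - b) \<le> 1"
  shows "a = b"
proof -
  obtain k g where a: "a = of_nat k / 2 ^ g" "k < 2 ^ g" using assms(1) by (auto simp: I2_eq)
  obtain l h where b: "b = of_nat l / 2 ^ h" "l < 2 ^ h" using assms(2) by (auto simp: I2_eq)
  define n where "n = int (k * 2 ^ h) - int (l * 2 ^ g)"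
  have ab: "a - b = of_int n / 2 ^ (g + h)" by (simp add: a b n_def field_simps power_add)
  have "norm2 (of_int n) \<le> 1 / 2 ^ (g + h)"
    using assms(3) unfolding ab norm2_divide norm2_2_power by (simp add: field_simps)
  hence dvd: "2 ^ (g + h) dvd n" by (simp only: norm2_of_int_le_iff)
  have "k * 2 ^ h < 2 ^ (g + h)" "l * 2 ^ g < 2 ^ (g + h)" using a b by (simp_all add: power_add)
  hence "int (k * 2 ^ h) < 2 ^ (g + h)" "int (l * 2 ^ g) < 2 ^ (g + h)"
    using of_nat_less_iff[of "k * 2 ^ h" "2 ^ (g + h)", where 'a = int]
      of_nat_less_iff[of "l * 2 ^ g" "2 ^ (g + h)", where 'a = int] by simp_all
  moreover have "0 \<le> int (k * 2 ^ h)" "0 \<le> int (l * 2 ^ g)" by simp_all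
  ultimately have "\<not> \<bar>2 ^ (g + h)\<bar> \<le> \<bar>n\<bar>" unfolding n_def by linarith
  hence "n = 0" using dvd dvd_imp_le_int by blast
  thus ?thesis using ab by simp
qed

text \<open>The function whose translates generate \<open>haar_V 1\<close>. Both
  \<open>haar_scaling\<close> and \<open>haar_psi0\<close> are combinations of it and its translate
  by 1, with signs + and -.\<close>

definition half_ball :: "q2 \<Rightarrow> complex" where
  "half_ball x = (if norm2 x \<le> 1 / 2 then 1 else 0)"

lemma half_ball_eq: "half_ball x = haar_scaling (x / 2)"
  by (simp add: half_ball_def haar_scaling_def Z2_def norm2_divide norm2_2)

lemma half_ball_uminus [simp]: "half_ball (- x) = half_ball x"
  by (simp add: half_ball_def)

lemma half_ball_shift:
  assumes "norm2 z \<le> 1 / 2"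
  shows "half_ball (x + z) = half_ball x"
proof -
  have "norm2 x \<le> 1 / 2" if "norm2 (x + z) \<le> 1 / 2"
    using norm2_diff[of "x + z" z] that assms by simp
  moreover have "norm2 (x + z) \<le> 1 / 2" if "norm2 x \<le> 1 / 2"
    using norm2_add[of x z] that assms by simp
  ultimately show ?thesis by (auto simp: half_ball_def)
qed

lemma half_ball_cong: "norm2 (x - y) \<le> 1 / 2 \<Longrightarrow> half_ball x = half_ball y"
  using half_ball_shift[of "x - y" y] by simp

lemma half_ball_plus_1: "half_ball (x + 1) = half_ball (x - 1)"
  by (rule half_ball_cong) (simp add: norm2_2)

lemma haar_scaling_eq: "haar_scaling x = half_ball x + half_ball (x - 1)"
proof -
  have "norm2 x \<le> 1" if "norm2 (x - 1) \<le> 1 / 2" using norm2_add[of "x - 1" 1] that by simp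
  moreover have "norm2 x \<le> 1" if "norm2 x \<le> 1 / 2" using that by simp
  ultimately show ?thesis
    using norm2_le_1_cases[of x] norm2_diff[of x "x - 1"]
    by (auto simp: half_ball_def haar_scaling_def Z2_def indicator_def)
qed

lemma haar_psi0_eq: "haar_psi0 x = half_ball x - half_ball (x - 1)"
  by (simp add: haar_psi0_def half_ball_eq diff_divide_distrib)

lemma haar_psi0_uminus: "haar_psi0 (- x) = haar_psi0 x"
proof -
  have "half_ball (- x - 1) = half_ball (x + 1)" using half_ball_uminus[of "x + 1"] by simp
  thus ?thesis by (simp add: haar_psi0_eq half_ball_plus_1)
qed

lemma haar_psi0_cong: "norm2 (x - y) \<le> 1 / 2 \<Longrightarrow> haar_psi0 x = haar_psi0 y"
  using half_ball_cong[of x y] half_ball_cong[of "x - 1" "y - 1"] by (simp add: haar_psi0_eq)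

lemma haar_psi0_minus_1: "haar_psi0 (x - 1) = - haar_psi0 x"
proof -
  have "half_ball (x - 1 - 1) = half_ball x" by (rule half_ball_cong) (simp add: norm2_2)
  thus ?thesis by (simp add: haar_psi0_eq)
qed

lemma haar_psi0_support: "norm2 x > 1 \<Longrightarrow> haar_psi0 x = 0"
  using norm2_add[of "x - 1" 1] by (auto simp: haar_psi0_eq half_ball_def)

lemma haar_psi0_0 [simp]: "haar_psi0 0 = 1"
  by (simp add: haar_psi0_eq half_ball_def)

text \<open>On Z2, \<open>haar_psi0\<close> is the nontrivial character of Z2 modulo 2 Z2, so a
  translation by \<open>z\<close> in Z2 acts by the sign \<open>haar_psi0 z\<close>.\<close>

lemma haar_psi0_shift:
  assumes "norm2 z \<le> 1"
  shows "haar_psi0 (x - z) = haar_psi0 z * haar_psi0 x"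
proof -
  from norm2_le_1_cases[OF assms] show ?thesis
  proof
    assume z: "norm2 z \<le> 1 / 2"
    thus ?thesis using haar_psi0_cong[of z 0] haar_psi0_cong[of "x - z" x] by simp
  next
    assume z: "norm2 (z - 1) \<le> 1 / 2"
    have "haar_psi0 z = - haar_psi0 (z - 1)" by (simp add: haar_psi0_minus_1)
    hence "haar_psi0 z = - 1" using haar_psi0_cong[of "z - 1" 0] z by simp
    moreover have "haar_psi0 (x - z) = - haar_psi0 x"
      using haar_psi0_cong[of "x - z" "x - 1"] z haar_psi0_minus_1[of x] by (simp add: norm2_minus_commute)
    ultimately show ?thesis by simp
  qed
qed

text \<open>Distinct representatives differ by more than 1 in norm, hence by a point outside the
  support.\<close>

lemma haar_psi0_I2:
  assumes "a \<in> I2" "b \<in> I2"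
  shows "haar_psi0 (a - b) = (if a = b then 1 else 0)"
  using I2_unique[OF assms] haar_psi0_support[of "a - b"] by force

lemma haar_scaling_cong: "norm2 (x - y) \<le> 1 \<Longrightarrow> haar_scaling x = haar_scaling y"
  using norm2_add[of "x - y" y] norm2_diff[of x "x - y"]
  by (auto simp: haar_scaling_def Z2_def indicator_def)

section \<open>Inner product, closure and span\<close>

lemma sets_haar2 [simp, measurable_cong]: "sets haar2 = sets borel"
  using is_haar2_haar2 by (simp add: is_haar2_def)

lemma space_haar2 [simp]: "space haar2 = UNIV"
  using sets_eq_imp_space_eq[OF sets_haar2] by simp

lemma L2_product_integrable:
  assumes "f \<in> L2" "g \<in> L2"
  shows "integrable haar2 (\<lambda>x. f x * cnj (g x))"
proof (rule Bochner_Integration.integrable_bound)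
  show "integrable haar2 (\<lambda>x. (cmod (f x))\<^sup>2 + (cmod (g x))\<^sup>2)"
    using assms by (auto simp: L2_def)
  have [measurable]: "f \<in> borel_measurable haar2" "g \<in> borel_measurable haar2"
    using assms by (auto simp: L2_def)
  have [measurable]: "cnj \<in> borel_measurable borel"
    by (intro borel_measurable_continuous_onI continuous_intros)
  show "(\<lambda>x. f x * cnj (g x)) \<in> borel_measurable haar2" by measurable
  show "AE x in haar2. norm (f x * cnj (g x)) \<le> norm ((cmod (f x))\<^sup>2 + (cmod (g x))\<^sup>2)"
  proof (rule AE_I2)
    fix x
    have "2 * (cmod (f x) * cmod (g x)) \<le> (cmod (f x))\<^sup>2 + (cmod (g x))\<^sup>2"
      using sum_squares_bound[of "cmod (f x)" "cmod (g x)"] by simp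
    hence "cmod (f x) * cmod (g x) \<le> (cmod (f x))\<^sup>2 + (cmod (g x))\<^sup>2"
      using mult_nonneg_nonneg[OF norm_ge_zero norm_ge_zero, of "f x" "g x"] by linarith
    thus "norm (f x * cnj (g x)) \<le> norm ((cmod (f x))\<^sup>2 + (cmod (g x))\<^sup>2)"
      by (simp add: norm_mult)
  qed
qed

lemma L2_add:
  assumes "f \<in> L2" "g \<in> L2"
  shows "(\<lambda>x. f x + g x) \<in> L2"
proof -
  have [measurable]: "f \<in> borel_measurable haar2" "g \<in> borel_measurable haar2"
    and i: "integrable haar2 (\<lambda>x. (cmod (f x))\<^sup>2)" "integrable haar2 (\<lambda>x. (cmod (g x))\<^sup>2)"
    using assms by (auto simp: L2_def)
  have "integrable haar2 (\<lambda>x. (cmod (f x + g x))\<^sup>2)"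
  proof (rule Bochner_Integration.integrable_bound)
    show "integrable haar2 (\<lambda>x. 2 * (cmod (f x))\<^sup>2 + 2 * (cmod (g x))\<^sup>2)" using i by auto
    show "(\<lambda>x. (cmod (f x + g x))\<^sup>2) \<in> borel_measurable haar2" by measurable
    show "AE x in haar2. norm ((cmod (f x + g x))\<^sup>2) \<le> norm (2 * (cmod (f x))\<^sup>2 + 2 * (cmod (g x))\<^sup>2)"
    proof (rule AE_I2)
      fix x
      have "(cmod (f x + g x))\<^sup>2 \<le> (cmod (f x) + cmod (g x))\<^sup>2"
        by (intro power_mono norm_triangle_ineq) simp
      also have "\<dots> \<le> 2 * (cmod (f x))\<^sup>2 + 2 * (cmod (g x))\<^sup>2"
        using sum_squares_bound[of "cmod (f x)" "cmod (g x)"] by (simp add: power2_sum)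
      finally show "norm ((cmod (f x + g x))\<^sup>2) \<le> norm (2 * (cmod (f x))\<^sup>2 + 2 * (cmod (g x))\<^sup>2)"
        by simp
    qed
  qed
  thus ?thesis by (simp add: L2_def)
qed

lemma L2_scale: "f \<in> L2 \<Longrightarrow> (\<lambda>x. c * f x) \<in> L2"
  by (auto simp: L2_def norm_mult power_mult_distrib)

lemma L2_diff: "f \<in> L2 \<Longrightarrow> g \<in> L2 \<Longrightarrow> (\<lambda>x. f x - g x) \<in> L2"
  using L2_add[of f "\<lambda>x. - 1 * g x"] L2_scale[of g "- 1"] by simp

lemma L2_0: "(\<lambda>x. 0) \<in> L2"
  by (simp add: L2_def)

lemma l2_inner_add_left:
  "f \<in> L2 \<Longrightarrow> g \<in> L2 \<Longrightarrow> h \<in> L2 \<Longrightarrow> l2_inner (\<lambda>x. f x + g x) h = l2_inner f h + l2_inner g h"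
  using L2_product_integrable[of f h] L2_product_integrable[of g h] by (simp add: l2_inner_def distrib_right)

lemma l2_inner_diff_left:
  "f \<in> L2 \<Longrightarrow> g \<in> L2 \<Longrightarrow> h \<in> L2 \<Longrightarrow> l2_inner (\<lambda>x. f x - g x) h = l2_inner f h - l2_inner g h"
  using L2_product_integrable[of f h] L2_product_integrable[of g h] by (simp add: l2_inner_def left_diff_distrib)

lemma l2_inner_scale_left: "l2_inner (\<lambda>x. c * f x) g = c * l2_inner f g"
  by (simp add: l2_inner_def mult.assoc)

lemma l2_inner_commute: "l2_inner g f = cnj (l2_inner f g)"
  unfolding l2_inner_def by (subst Bochner_Integration.integral_cnj[symmetric]) (simp add: mult.commute)

lemma l2_inner_diff_right:
  "f \<in> L2 \<Longrightarrow> g \<in> L2 \<Longrightarrow> h \<in> L2 \<Longrightarrow> l2_inner h (\<lambda>x. f x - g x) = l2_inner h f - l2_inner h g"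
  by (simp add: l2_inner_commute[of h] l2_inner_diff_left)

lemma l2_inner_add_right:
  "f \<in> L2 \<Longrightarrow> g \<in> L2 \<Longrightarrow> h \<in> L2 \<Longrightarrow> l2_inner h (\<lambda>x. f x + g x) = l2_inner h f + l2_inner h g"
  by (simp add: l2_inner_commute[of h] l2_inner_add_left)

lemma L2_sum: "(\<And>i. i \<in> I \<Longrightarrow> f i \<in> L2) \<Longrightarrow> (\<lambda>x. \<Sum>i\<in>I. c i * f i x) \<in> L2"
  by (induction I rule: infinite_finite_induct) (auto intro!: L2_0 L2_add L2_scale)

lemma l2_inner_sum_left:
  assumes "\<And>i. i \<in> I \<Longrightarrow> f i \<in> L2" "g \<in> L2"
  shows "l2_inner (\<lambda>x. \<Sum>i\<in>I. c i * f i x) g = (\<Sum>i\<in>I. c i * l2_inner (f i) g)"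
  using assms(1)
proof (induction I rule: infinite_finite_induct)
  case (insert i I)
  thus ?case using assms(2) by (simp add: l2_inner_add_left l2_inner_scale_left L2_scale L2_sum)
qed (simp_all add: l2_inner_def)

lemma l2_inner_sum_right:
  assumes "\<And>i. i \<in> I \<Longrightarrow> f i \<in> L2" "g \<in> L2"
  shows "l2_inner g (\<lambda>x. \<Sum>i\<in>I. c i * f i x) = (\<Sum>i\<in>I. cnj (c i) * l2_inner g (f i))"
  by (simp add: l2_inner_commute[of g] l2_inner_sum_left assms)

lemma l2_norm_Re_inner: "l2_norm f = sqrt (Re (l2_inner f f))"
proof -
  have "l2_inner f f = complex_of_real (LINT x|haar2. (cmod (f x))\<^sup>2)"
    unfolding l2_inner_def integral_complex_of_real[symmetric] by (simp only: complex_norm_square)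
  thus ?thesis by (simp add: l2_norm_def)
qed

lemma l2_norm_sq: "(l2_norm f)\<^sup>2 = (LINT x|haar2. (cmod (f x))\<^sup>2)"
  by (simp add: l2_norm_def)

lemma l2_norm_le_of_orthogonal:
  assumes "f \<in> L2" "g \<in> L2" "l2_inner f g = 0"
  shows "l2_norm f \<le> l2_norm (\<lambda>x. f x - g x)"
proof -
  have fg: "(\<lambda>x. f x - g x) \<in> L2" using assms by (intro L2_diff)
  have "l2_inner g f = 0" using assms(3) l2_inner_commute[of g f] by simp
  hence "l2_inner (\<lambda>x. f x - g x) (\<lambda>x. f x - g x) = l2_inner f f + l2_inner g g"
    using assms fg by (simp add: l2_inner_diff_left l2_inner_diff_right)
  moreover have "0 \<le> l2_norm g" by (simp add: l2_norm_def)
  hence "0 \<le> Re (l2_inner g g)" by (simp add: l2_norm_Re_inner)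
  ultimately show ?thesis unfolding l2_norm_Re_inner by (intro real_sqrt_le_mono) simp
qed

text \<open>A weighted AM-GM inequality stands in for the Cauchy-Schwarz inequality.\<close>

lemma l2_inner_small:
  assumes "f \<in> L2" "g \<in> L2" "e > 0" "l2_norm f < e"
  shows "cmod (l2_inner f g) \<le> e * (1 + (l2_norm g)\<^sup>2)"
proof -
  have i: "integrable haar2 (\<lambda>x. (cmod (f x))\<^sup>2)" "integrable haar2 (\<lambda>x. (cmod (g x))\<^sup>2)"
    using assms by (auto simp: L2_def)
  have "cmod (l2_inner f g) \<le> (LINT x|haar2. cmod (f x * cnj (g x)))"
    unfolding l2_inner_def by (rule integral_norm_bound)
  \<comment> \<open>The weight \<open>e\<close> is matched to the bound on \<open>f\<close>: the
    first term integrates to at most e^2 / e, so both terms are of order \<open>e\<close>.\<close>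
  also have "\<dots> \<le> (LINT x|haar2. (cmod (f x))\<^sup>2 / e + e * (cmod (g x))\<^sup>2)"
  proof (rule integral_mono)
    show "integrable haar2 (\<lambda>x. cmod (f x * cnj (g x)))"
      using L2_product_integrable[OF assms(1,2)] by (rule integrable_norm)
    show "integrable haar2 (\<lambda>x. (cmod (f x))\<^sup>2 / e + e * (cmod (g x))\<^sup>2)" using i by auto
    fix x
    have "0 \<le> (cmod (f x) - e * cmod (g x))\<^sup>2" by simp
    hence "2 * (e * (cmod (f x) * cmod (g x))) \<le> (cmod (f x))\<^sup>2 + e * (e * (cmod (g x))\<^sup>2)"
      by (simp add: power2_eq_square algebra_simps)
    moreover have "0 \<le> e * (cmod (f x) * cmod (g x))" using assms(3) by simp
    ultimately have "e * (cmod (f x) * cmod (g x)) \<le> (cmod (f x))\<^sup>2 + e * (e * (cmod (g x))\<^sup>2)" by linarith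
    also have "\<dots> = e * ((cmod (f x))\<^sup>2 / e + e * (cmod (g x))\<^sup>2)"
      using assms(3) by (simp add: algebra_simps)
    finally show "cmod (f x * cnj (g x)) \<le> (cmod (f x))\<^sup>2 / e + e * (cmod (g x))\<^sup>2"
      using assms(3) by (simp add: norm_mult)
  qed
  also have "\<dots> = (l2_norm f)\<^sup>2 / e + e * (l2_norm g)\<^sup>2"
    using i by (simp add: l2_norm_sq)
  also have "(l2_norm f)\<^sup>2 / e \<le> e"
  proof -
    have "(l2_norm f)\<^sup>2 \<le> e\<^sup>2" using assms(4) by (intro power_mono) (auto simp: l2_norm_def)
    thus ?thesis using assms(3) by (simp add: field_simps power2_eq_square)
  qed
  finally show ?thesis by (simp add: algebra_simps)
qed

text \<open>Continuity of the inner product: subtracting an approximant \<open>h\<close> from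
  \<open>f\<close> leaves the inner product with \<open>g\<close> unchanged.\<close>

lemma l2_closure_orthogonal:
  assumes "f \<in> l2_closure S" "g \<in> L2" "\<And>h. h \<in> S \<Longrightarrow> h \<in> L2 \<Longrightarrow> l2_inner h g = 0"
  shows "l2_inner f g = 0"
proof -
  have f: "f \<in> L2" using assms(1) by (simp add: l2_closure_def)
  have "cmod (l2_inner f g) \<le> e" if e: "e > 0" for e
  proof -
    define C where "C = 1 + (l2_norm g)\<^sup>2"
    have C: "C > 0" by (simp add: C_def add_pos_nonneg)
    obtain h where h: "h \<in> S" "h \<in> L2" "l2_norm (\<lambda>x. f x - h x) < e / C"
      using assms(1) divide_pos_pos[OF e C] unfolding l2_closure_def by blast
    have "l2_inner f g = l2_inner (\<lambda>x. f x - h x) g"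
      using f h assms by (simp add: l2_inner_diff_left)
    also have "cmod \<dots> \<le> e / C * C"
      unfolding C_def by (rule l2_inner_small) (use f h assms e C in \<open>auto simp: C_def intro: L2_diff\<close>)
    finally show ?thesis using C by simp
  qed
  hence "cmod (l2_inner f g) \<le> 0" by (rule field_le_epsilon) simp
  thus ?thesis by simp
qed

section \<open>Monotonicity of closures and calculus of finite linear spans\<close>

lemma l2_closure_mono: "S \<subseteq> T \<Longrightarrow> l2_closure S \<subseteq> l2_closure T"
  unfolding l2_closure_def by blast

lemma l2_closure_superset: "S \<inter> L2 \<subseteq> l2_closure S"
  unfolding l2_closure_def by (auto simp: l2_norm_def intro!: bexI)

lemma cspan_base: "f \<in> S \<Longrightarrow> f \<in> cspan S"
  unfolding cspan_def by (intro CollectI exI[of _ "{f}"] exI[of _ "\<lambda>_. 1"]) auto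

lemma cspan_0: "(\<lambda>x. 0) \<in> cspan S"
  unfolding cspan_def by (intro CollectI exI[of _ "{}"]) auto

lemma cspan_scale:
  assumes "f \<in> cspan S"
  shows "(\<lambda>x. c * f x) \<in> cspan S"
proof -
  obtain F d where "f = (\<lambda>x. \<Sum>f\<in>F. d f * f x)" "finite F" "F \<subseteq> S" using assms by (auto simp: cspan_def)
  thus ?thesis unfolding cspan_def
    by (intro CollectI exI[of _ F] exI[of _ "\<lambda>f. c * d f"]) (auto simp: sum_distrib_left mult.assoc)
qed

lemma cspan_add:
  assumes "f \<in> cspan S" "g \<in> cspan S"
  shows "(\<lambda>x. f x + g x) \<in> cspan S"
proof -
  obtain F c where f: "f = (\<lambda>x. \<Sum>f\<in>F. c f * f x)" "finite F" "F \<subseteq> S" using assms(1) by (auto simp: cspan_def)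
  obtain G d where g: "g = (\<lambda>x. \<Sum>f\<in>G. d f * f x)" "finite G" "G \<subseteq> S" using assms(2) by (auto simp: cspan_def)
  \<comment> \<open>\<open>F\<close> and \<open>G\<close> may share functions, whose coefficients
    then add up; extension by zero brings both sums to the index set
    \<open>F \<union> G\<close>.\<close>
  have extend: "(\<Sum>h\<in>H. e h * h x) = (\<Sum>h\<in>F \<union> G. (if h \<in> H then e h else 0) * h x)"
    if "H \<subseteq> F \<union> G" for H x and e :: "(q2 \<Rightarrow> complex) \<Rightarrow> complex"
    using that f(2) g(2) by (intro sum.mono_neutral_cong_left) auto
  have "(\<lambda>x. f x + g x) = (\<lambda>x. \<Sum>h\<in>F \<union> G. ((if h \<in> F then c h else 0) + (if h \<in> G then d h else 0)) * h x)"
    unfolding f(1) g(1) distrib_right sum.distrib by (subst (1 2) extend) auto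
  thus ?thesis unfolding cspan_def using f g
    by (intro CollectI exI[of _ "F \<union> G"]
        exI[of _ "\<lambda>h. (if h \<in> F then c h else 0) + (if h \<in> G then d h else 0)"]) simp
qed

lemma cspan_sum: "(\<And>i. i \<in> I \<Longrightarrow> f i \<in> cspan S) \<Longrightarrow> (\<lambda>x. \<Sum>i\<in>I. c i * f i x) \<in> cspan S"
  by (induction I rule: infinite_finite_induct) (auto intro!: cspan_0 cspan_add cspan_scale)

lemma cspan_least: "T \<subseteq> cspan S \<Longrightarrow> cspan T \<subseteq> cspan S"
  unfolding cspan_def[of T] by (auto intro!: cspan_sum)

lemma cspan_subset_L2: "S \<subseteq> L2 \<Longrightarrow> cspan S \<subseteq> L2"
  unfolding cspan_def by (auto intro!: L2_sum)

lemma cspan_orthogonal: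
  assumes "f \<in> cspan S" "S \<subseteq> L2" "g \<in> L2" "\<And>h. h \<in> S \<Longrightarrow> l2_inner h g = 0"
  shows "l2_inner f g = 0"
proof -
  obtain F c where f: "f = (\<lambda>x. \<Sum>f\<in>F. c f * f x)" "F \<subseteq> S" using assms(1) by (auto simp: cspan_def)
  have "l2_inner f g = (\<Sum>f\<in>F. c f * l2_inner f g)"
    unfolding f(1) using assms f by (intro l2_inner_sum_left) auto
  thus ?thesis using assms(4) f(2) by (simp add: subset_iff)
qed

section \<open>The spaces of the multiresolution analysis\<close>

lemma measure_cball_q2: "measure haar2 (cball a (1 / 2 ^ n)) = 1 / 2 ^ n"
  "emeasure haar2 (cball a (1 / 2 ^ n)) = ennreal (1 / 2 ^ n)" for a :: q2
proof -
  obtain k where "cball a (1 / 2 ^ n) = qball n k" using cball_q2_qball by blast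
  thus e: "emeasure haar2 (cball a (1 / 2 ^ n)) = ennreal (1 / 2 ^ n)"
    using is_haar2_emeasure_qball[OF is_haar2_haar2, of n k] by (simp add: ennreal_half_power)
  show "measure haar2 (cball a (1 / 2 ^ n)) = 1 / 2 ^ n" unfolding measure_def e by simp
qed

lemma half_ball_translate: "(\<lambda>x. half_ball (x - b)) = indicator (cball b (1 / 2))"
  by (auto simp: half_ball_def cball_q2 indicator_def)

lemma half_ball_L2 [simp]: "(\<lambda>x. half_ball (x - b)) \<in> L2"
proof -
  have "(cmod (indicator (cball b (1 / 2)) x))\<^sup>2 = indicator (cball b (1 / 2)) x" for x :: q2
    by (simp add: indicator_def)
  moreover have "emeasure haar2 (cball b (1 / 2)) < \<infinity>"
    using measure_cball_q2(2)[of b 1] ennreal_less_top[of "1 / 2"] by (simp only: power_one_right infinity_ennreal_def)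
  ultimately show ?thesis unfolding half_ball_translate L2_def
    by (auto simp: integrable_indicator_iff intro!: borel_measurable_indicator)
qed

text \<open>By the ultrametric inequality two balls of radius 1/2 coincide or are disjoint, and each
  has measure 1/2.\<close>

lemma l2_inner_half_ball: "l2_inner (\<lambda>x. half_ball (x - b)) (\<lambda>x. half_ball (x - c)) = half_ball (b - c) / 2"
proof (cases "norm2 (b - c) \<le> 1 / 2")
  case True
  have "half_ball (x - c) = half_ball (x - b)" for x using True by (intro half_ball_cong) simp
  hence "half_ball (x - b) * cnj (half_ball (x - c)) = complex_of_real (indicator (cball b (1 / 2)) x)" for x
    by (auto simp: half_ball_def cball_q2 indicator_def)
  hence "l2_inner (\<lambda>x. half_ball (x - b)) (\<lambda>x. half_ball (x - c)) = of_real (measure haar2 (cball b (1 / 2)))"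
    by (simp add: l2_inner_def)
  also have "measure haar2 (cball b (1 / 2)) = 1 / 2" using measure_cball_q2(1)[of b 1] by simp
  finally show ?thesis using True by (simp add: half_ball_def)
next
  case False
  have "half_ball (x - b) * cnj (half_ball (x - c)) = 0" for x
    using norm2_diff[of "x - c" "x - b"] False by (auto simp: half_ball_def)
  hence "l2_inner (\<lambda>x. half_ball (x - b)) (\<lambda>x. half_ball (x - c)) = 0"
    unfolding l2_inner_def by (simp only:) simp
  thus ?thesis using False by (simp add: half_ball_def)
qed

lemma haar_psi0_translate: "(\<lambda>x. haar_psi0 (x - b)) = (\<lambda>x. half_ball (x - b) - half_ball (x - (b + 1)))"
  by (simp add: haar_psi0_eq diff_diff_eq)

lemma haar_scaling_translate: "(\<lambda>x. haar_scaling (x - b)) = (\<lambda>x. half_ball (x - b) + half_ball (x - (b + 1)))"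
  by (simp add: haar_scaling_eq diff_diff_eq)

lemma haar_psi0_L2 [simp]: "(\<lambda>x. haar_psi0 (x - b)) \<in> L2"
  unfolding haar_psi0_translate by (intro L2_diff half_ball_L2)

lemma haar_scaling_L2 [simp]: "(\<lambda>x. haar_scaling (x - b)) \<in> L2"
  unfolding haar_scaling_translate by (intro L2_add half_ball_L2)

text \<open>Of the four products of half-balls, those of equal sign agree, because
  \<open>half_ball\<close> has period 2. Each has weight 1/2, so the pairs add up to
  \<open>haar_psi0\<close> again.\<close>

lemma l2_inner_haar_psi0: "l2_inner (\<lambda>x. haar_psi0 (x - b)) (\<lambda>x. haar_psi0 (x - c)) = haar_psi0 (b - c)"
proof -
  have "half_ball (b - (c + 1)) = half_ball (b - c - 1)" "half_ball (b + 1 - c) = half_ball (b - c - 1)"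
    "half_ball (b + 1 - (c + 1)) = half_ball (b - c)"
    using half_ball_plus_1[of "b - c"] by (simp_all add: algebra_simps)
  thus ?thesis unfolding haar_psi0_translate
    by (simp add: l2_inner_diff_left l2_inner_diff_right L2_diff l2_inner_half_ball haar_psi0_eq)
qed

text \<open>The two half-balls of a translate of \<open>haar_psi0\<close> have the same inner
  product with a translate of \<open>haar_scaling\<close>, so their difference is orthogonal to
  it.\<close>

lemma l2_inner_haar_psi0_scaling: "l2_inner (\<lambda>x. haar_psi0 (x - b)) (\<lambda>x. haar_scaling (x - c)) = 0"
proof -
  have eq: "half_ball (b - (c + 1)) = half_ball (b - c - 1)" "half_ball (b + 1 - c) = half_ball (b - c - 1)"
    "half_ball (b + 1 - (c + 1)) = half_ball (b - c)"
    using half_ball_plus_1[of "b - c"] by (simp_all add: algebra_simps)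
  have "l2_inner (\<lambda>x. half_ball (x - d)) (\<lambda>x. haar_scaling (x - c)) = half_ball (d - c) / 2 + half_ball (d - (c + 1)) / 2" for d
    unfolding haar_scaling_translate by (simp add: l2_inner_add_right l2_inner_half_ball)
  thus ?thesis unfolding haar_psi0_translate
    by (simp add: l2_inner_diff_left eq)
qed

definition translates :: "(q2 \<Rightarrow> complex) \<Rightarrow> (q2 \<Rightarrow> complex) set" where
  "translates f = range (\<lambda>b x. f (x - b))"

lemma translate_in_cspan: "(\<lambda>x. f (x - b)) \<in> cspan (translates f)"
  by (rule cspan_base) (auto simp: translates_def)

lemma translates_eq_I2:
  assumes "\<And>x y. norm2 (x - y) \<le> 1 \<Longrightarrow> f x = f y"
  shows "(\<lambda>a x. f (x - a)) ` I2 = translates f"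
proof (intro equalityI subsetI)
  fix g assume "g \<in> translates f"
  then obtain b where g: "g = (\<lambda>x. f (x - b))" by (auto simp: translates_def)
  obtain a where a: "a \<in> I2" "norm2 (b - a) \<le> 1" using I2_representative by blast
  have "f (x - b) = f (x - a)" for x
    using a(2) by (intro assms) (simp add: norm2_minus_commute)
  thus "g \<in> (\<lambda>a x. f (x - a)) ` I2" using a(1) g by auto
qed (auto simp: translates_def)

text \<open>A shift by \<open>b\<close> differs from the shift by its representative by an element
  of Z2, which acts on \<open>f\<close> as a scalar. The generating sets may differ; the spans do
  not.\<close>

lemma cspan_translates_eq_I2:
  assumes "\<And>z. norm2 z \<le> 1 \<Longrightarrow> \<exists>c. \<forall>x. f (x - z) = c * f x"
  shows "cspan ((\<lambda>a x. f (x - a)) ` I2) = cspan (translates f)"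
proof (intro equalityI cspan_least subsetI)
  fix g assume "g \<in> translates f"
  then obtain b where g: "g = (\<lambda>x. f (x - b))" by (auto simp: translates_def)
  obtain a where a: "a \<in> I2" "norm2 (b - a) \<le> 1" using I2_representative by blast
  obtain c where c: "\<And>x. f (x - (b - a)) = c * f x" using assms[OF a(2)] by blast
  have "g = (\<lambda>x. c * f (x - a))" using c[of "_ - a"] by (simp add: g)
  thus "g \<in> cspan ((\<lambda>a x. f (x - a)) ` I2)" using a(1) by (simp add: cspan_scale cspan_base)
qed (auto simp: translates_def intro: cspan_base)

lemma haar_V_0_eq: "haar_V 0 = l2_closure (cspan (translates haar_scaling))"
  using translates_eq_I2[of haar_scaling, OF haar_scaling_cong] by (simp add: haar_V_def)

text \<open>Taking the factor 1/2 out turns the index set into 2 \<open>I2\<close>, which represents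
  the field modulo 2 Z2, and \<open>half_ball\<close> is invariant under 2 Z2.\<close>

lemma haar_V_1_eq: "haar_V 1 = l2_closure (cspan (translates half_ball))"
proof -
  have "2 powi (- 1) * x - a = (x - 2 * a) / 2" for x a :: q2
    by (simp add: power_int_minus field_simps)
  hence "(\<lambda>a x. haar_scaling (2 powi (- 1) * x - a)) ` I2 = (\<lambda>a x. half_ball (x - 2 * a)) ` I2"
    by (simp only: half_ball_eq)
  also have "\<dots> = translates half_ball"
  proof (intro equalityI subsetI)
    fix g assume "g \<in> translates half_ball"
    then obtain b where g: "g = (\<lambda>x. half_ball (x - b))" by (auto simp: translates_def)
    obtain a where a: "a \<in> I2" "norm2 (b / 2 - a) \<le> 1" using I2_representative by blast
    have "b - 2 * a = 2 * (b / 2 - a)" by simp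
    hence "norm2 (b - 2 * a) \<le> 1 / 2" using a(2) by (simp only: norm2_mult norm2_2)
    hence "half_ball (x - b) = half_ball (x - 2 * a)" for x
      by (intro half_ball_cong) (simp add: norm2_minus_commute)
    thus "g \<in> (\<lambda>a x. half_ball (x - 2 * a)) ` I2" using a(1) g by auto
  qed (auto simp: translates_def)
  finally show ?thesis by (simp add: haar_V_def)
qed

text \<open>Each generator is half the sum of a translate of \<open>haar_scaling\<close> and the
  corresponding translate of \<open>haar_psi0\<close>.\<close>

lemma cspan_half_ball_split:
  assumes "g \<in> cspan (translates half_ball)"
  shows "\<exists>u\<in>cspan (translates haar_scaling). \<exists>h\<in>cspan (translates haar_psi0). g = (\<lambda>x. u x + h x)"
proof -
  obtain F c where g: "g = (\<lambda>x. \<Sum>f\<in>F. c f * f x)" "F \<subseteq> translates half_ball"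
    using assms by (auto simp: cspan_def)
  have "\<forall>f\<in>F. \<exists>b. f = (\<lambda>x. half_ball (x - b))" using g(2) by (auto simp: translates_def)
  then obtain b where b: "\<And>f. f \<in> F \<Longrightarrow> f = (\<lambda>x. half_ball (x - b f))" by metis
  define u where "u = (\<lambda>x. \<Sum>f\<in>F. (c f / 2) * haar_scaling (x - b f))"
  define h where "h = (\<lambda>x. \<Sum>f\<in>F. (c f / 2) * haar_psi0 (x - b f))"
  have "g x = u x + h x" for x
    unfolding g(1) u_def h_def sum.distrib[symmetric]
  proof (rule sum.cong[OF refl])
    fix f assume "f \<in> F"
    hence "f x = half_ball (x - b f)" by (metis b)
    thus "c f * f x = c f / 2 * haar_scaling (x - b f) + c f / 2 * haar_psi0 (x - b f)"
      by (simp add: haar_scaling_eq haar_psi0_eq field_simps)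
  qed
  moreover have "u \<in> cspan (translates haar_scaling)" "h \<in> cspan (translates haar_psi0)"
    unfolding u_def h_def by (rule cspan_sum, rule translate_in_cspan)+
  ultimately show ?thesis by blast
qed

lemma translates_L2:
  "translates half_ball \<subseteq> L2" "translates haar_scaling \<subseteq> L2" "translates haar_psi0 \<subseteq> L2"
  by (auto simp: translates_def)

text \<open>For the inclusion from left to right, an approximant from \<open>V1\<close> splits as \<open>u + h\<close> with \<open>u\<close> in \<open>V0\<close>.
  Dropping \<open>u\<close> does not increase the distance to an element of \<open>W0\<close>, since \<open>W0\<close> is orthogonal to \<open>u\<close>.\<close>

lemma haar_W0_eq: "haar_W0 = l2_closure (cspan (translates haar_psi0))"
proof (intro equalityI subsetI)
  fix f assume f: "f \<in> haar_W0"
  hence fL2: "f \<in> L2" and V1: "f \<in> l2_closure (cspan (translates half_ball))"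
    by (auto simp: haar_W0_def haar_V_1_eq l2_closure_def)
  have "\<exists>h\<in>cspan (translates haar_psi0) \<inter> L2. l2_norm (\<lambda>x. f x - h x) < e" if e: "e > 0" for e
  proof -
    obtain g where g: "g \<in> cspan (translates half_ball)" "g \<in> L2" "l2_norm (\<lambda>x. f x - g x) < e"
      using V1 e by (auto simp: l2_closure_def)
    obtain u h where u: "u \<in> cspan (translates haar_scaling)" and h: "h \<in> cspan (translates haar_psi0)"
      and gx: "g = (\<lambda>x. u x + h x)" using cspan_half_ball_split[OF g(1)] by blast
    have uL2: "u \<in> L2" and hL2: "h \<in> L2"
      using u h cspan_subset_L2 translates_L2 by blast+
    have "u \<in> haar_V 0" unfolding haar_V_0_eq using u uL2 l2_closure_superset by blast
    hence "l2_inner f u = 0" using f by (simp add: haar_W0_def)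
    moreover have "l2_inner h u = 0"
    proof (rule cspan_orthogonal[OF h translates_L2(3) uL2])
      fix k assume "k \<in> translates haar_psi0"
      then obtain c where k: "k = (\<lambda>x. haar_psi0 (x - c))" by (auto simp: translates_def)
      have "l2_inner u k = 0"
      proof (rule cspan_orthogonal[OF u translates_L2(2)])
        fix v assume "v \<in> translates haar_scaling"
        thus "l2_inner v k = 0"
          using l2_inner_haar_psi0_scaling l2_inner_commute[of v k] by (auto simp: translates_def k)
      qed (simp add: k)
      thus "l2_inner k u = 0" using l2_inner_commute[of k u] by simp
    qed
    ultimately have "l2_inner (\<lambda>x. f x - h x) u = 0"
      using fL2 hL2 uL2 by (simp add: l2_inner_diff_left)
    hence "l2_norm (\<lambda>x. f x - h x) \<le> l2_norm (\<lambda>x. f x - h x - u x)"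
      using fL2 hL2 uL2 by (intro l2_norm_le_of_orthogonal L2_diff)
    also have "(\<lambda>x. f x - h x - u x) = (\<lambda>x. f x - g x)" by (auto simp: gx algebra_simps)
    finally show ?thesis using g(3) h hL2 by (intro bexI[of _ h]) auto
  qed
  thus "f \<in> l2_closure (cspan (translates haar_psi0))" using fL2 by (auto simp: l2_closure_def)
next
  fix f assume f: "f \<in> l2_closure (cspan (translates haar_psi0))"
  have "translates haar_psi0 \<subseteq> cspan (translates half_ball)"
  proof
    fix g assume "g \<in> translates haar_psi0"
    then obtain b where "g = (\<lambda>x. haar_psi0 (x - b))" by (auto simp: translates_def)
    hence "g = (\<lambda>x. half_ball (x - b) + - 1 * half_ball (x - (b + 1)))" by (simp add: haar_psi0_translate)
    thus "g \<in> cspan (translates half_ball)"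
      by (simp only: cspan_add cspan_scale translate_in_cspan)
  qed
  hence "f \<in> haar_V 1" unfolding haar_V_1_eq using f l2_closure_mono cspan_least by blast
  moreover have "l2_inner f g = 0" if g: "g \<in> haar_V 0" for g
  proof -
    have gL2: "g \<in> L2" using g by (simp add: haar_V_def l2_closure_def)
    show ?thesis
    proof (rule l2_closure_orthogonal[OF f gL2])
      fix h assume h: "h \<in> cspan (translates haar_psi0)" "h \<in> L2"
      show "l2_inner h g = 0"
      proof (rule cspan_orthogonal[OF h(1) translates_L2(3) gL2])
        fix k assume "k \<in> translates haar_psi0"
        then obtain c where k: "k = (\<lambda>x. haar_psi0 (x - c))" by (auto simp: translates_def)
        have "l2_inner g k = 0"
        proof (rule l2_closure_orthogonal[OF g[unfolded haar_V_0_eq]])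
          fix u assume u: "u \<in> cspan (translates haar_scaling)"
          show "l2_inner u k = 0"
          proof (rule cspan_orthogonal[OF u translates_L2(2)])
            fix v assume "v \<in> translates haar_scaling"
            thus "l2_inner v k = 0"
              using l2_inner_haar_psi0_scaling l2_inner_commute[of v k] by (auto simp: translates_def k)
          qed (simp add: k)
        qed (simp add: k)
        thus "l2_inner k g = 0" using l2_inner_commute[of k g] by simp
      qed
    qed
  qed
  ultimately show "f \<in> haar_W0" by (simp add: haar_W0_def)
qed

text \<open>The norm of \<open>n / 2^s\<close> is at most 1/2 exactly if \<open>2^(s+1)\<close>
  divides \<open>n\<close>, and subtracting 1 lowers the numerator by \<open>2^s\<close>.\<close>

lemma haar_psi0_dyadic: "haar_psi0 (of_int n / 2 ^ s) = antiperiod (2 ^ s) n"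
proof -
  have "norm2 (of_int n / 2 ^ s) \<le> 1 / 2 \<longleftrightarrow> norm2 (of_int n) \<le> 1 / 2 ^ Suc s" for n
    by (simp add: norm2_divide norm2_2_power field_simps)
  hence half: "half_ball (of_int n / 2 ^ s) = (if 2 * int (2 ^ s) dvd n then 1 else 0)" for n
    unfolding half_ball_def norm2_of_int_le_iff by simp
  have "(of_int n / 2 ^ s - 1 :: q2) = of_int (n - int (2 ^ s)) / 2 ^ s" by (simp add: field_simps)
  thus ?thesis unfolding haar_psi0_eq antiperiod_def by (simp only: half)
qed

section \<open>Autocorrelation of the coefficients: from dyadic points to Q_2\<close>

lemma autocorrelation_dyadic:
  "(\<Sum>k<2^s. \<Sum>l<2^s. \<alpha> k * cnj (\<alpha> l) * haar_psi0 (of_int m / 2 ^ s + of_nat k / 2 ^ s - of_nat l / 2 ^ s))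
    = (\<Sum>k<2^s. \<Sum>l<2^s. \<alpha> k * cnj (\<alpha> l) * antiperiod (2 ^ s) (m + int k - int l))"
proof -
  have "(of_int m / 2 ^ s + of_nat k / 2 ^ s - of_nat l / 2 ^ s :: q2) = of_int (m + int k - int l) / 2 ^ s" for k l
    by (simp add: add_divide_distrib diff_divide_distrib)
  thus ?thesis by (simp only: haar_psi0_dyadic)
qed

text \<open>Both sides depend on \<open>b\<close> only modulo \<open>2 Z2\<close> and vanish off \<open>2^(-s) Z2\<close>, which reduces the
  claim to \<open>b = m / 2^s\<close>.\<close>

lemma autocorrelation_q2:
  assumes "s \<ge> 1" "\<And>r. r < 2 ^ s \<Longrightarrow> cmod (symbol (2 ^ s) \<alpha> r) = 1"
  shows "(\<Sum>k<2^s. \<Sum>l<2^s. \<alpha> k * cnj (\<alpha> l) * haar_psi0 (b + of_nat k / 2 ^ s - of_nat l / 2 ^ s)) = haar_psi0 b"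
proof (cases "norm2 (2 ^ s * b) \<le> 1")
  case True
  \<comment> \<open>The exponent is \<open>Suc s\<close> so that division by \<open>2^s\<close>
    leaves an error of at most 1/2, within which \<open>haar_psi0\<close> does not change.\<close>
  then obtain m where m: "norm2 (2 ^ s * b - of_nat m) \<le> 1 / 2 ^ Suc s" using of_nat_dense_Z2 by blast
  have "2 ^ s * b - of_nat m = 2 ^ s * (b - of_int (int m) / 2 ^ s)" by (simp add: field_simps)
  hence "norm2 (2 ^ s * b - of_nat m) = norm2 (b - of_int (int m) / 2 ^ s) / 2 ^ s"
    by (simp only: norm2_mult norm2_2_power) simp
  hence bm: "norm2 (b - of_int (int m) / 2 ^ s) \<le> 1 / 2" using m by (simp add: field_simps)
  have "haar_psi0 (b + of_nat k / 2 ^ s - of_nat l / 2 ^ s)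
      = haar_psi0 (of_int (int m) / 2 ^ s + of_nat k / 2 ^ s - of_nat l / 2 ^ s)" for k l
    using bm by (intro haar_psi0_cong) (simp add: algebra_simps)
  moreover have "haar_psi0 b = haar_psi0 (of_int (int m) / 2 ^ s)" using bm by (rule haar_psi0_cong)
  ultimately show ?thesis
    using autocorrelation_unimodular[of "2 ^ s" \<alpha> "int m"] assms
    by (simp only: autocorrelation_dyadic haar_psi0_dyadic) simp
next
  case False
  \<comment> \<open>2^(-s) Z2 is a group that contains the support of \<open>haar_psi0\<close>; a
    shift \<open>z\<close> in it cannot bring \<open>b\<close> from outside into the
    support.\<close>
  have "haar_psi0 (b + z) = 0" if z: "norm2 (2 ^ s * z) \<le> 1" for z
  proof (rule haar_psi0_support, rule ccontr)
    assume "\<not> 1 < norm2 (b + z)"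
    hence "norm2 (b + z) \<le> 2 ^ s" using one_le_power[of "2::real" s] by linarith
    hence "norm2 (2 ^ s * (b + z)) \<le> 1" unfolding norm2_mult norm2_2_power by simp
    moreover have "2 ^ s * b = 2 ^ s * (b + z) - 2 ^ s * z" by (simp add: algebra_simps)
    ultimately have "norm2 (2 ^ s * b) \<le> 1" using z norm2_diff[of "2 ^ s * (b + z)" "2 ^ s * z"]
      by (metis dual_order.trans max.bounded_iff)
    thus False using False by simp
  qed
  note zero = this
  have "norm2 (2 ^ s * (of_nat k / 2 ^ s - of_nat l / 2 ^ s)) \<le> 1" for k l
    using norm2_of_int_le_1[of "int k - int l"] by (simp add: algebra_simps)
  from zero[OF this] have "haar_psi0 (b + of_nat k / 2 ^ s - of_nat l / 2 ^ s) = 0" for k l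
    by (simp add: add_diff_eq)
  moreover have "haar_psi0 b = 0" using zero[of 0] by simp
  ultimately show ?thesis by simp
qed

lemma l2_inner_haar_combination:
  "l2_inner (\<lambda>x. \<Sum>k<2^s. \<alpha> k * haar_psi0 (x - a - of_nat k / 2 ^ s))
      (\<lambda>x. \<Sum>k<2^s. \<alpha> k * haar_psi0 (x - b - of_nat k / 2 ^ s))
    = (\<Sum>k<2^s. \<Sum>l<2^s. \<alpha> k * cnj (\<alpha> l) * haar_psi0 (a - b + of_nat k / 2 ^ s - of_nat l / 2 ^ s))"
proof -
  have "a + of_nat k / 2 ^ s - (b + of_nat l / 2 ^ s) = a - b + of_nat k / 2 ^ s - of_nat l / 2 ^ s" for k l
    by (simp add: diff_diff_eq2 algebra_simps)
  thus ?thesis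
    by (simp only: diff_diff_eq l2_inner_sum_left l2_inner_sum_right L2_sum haar_psi0_L2
        l2_inner_haar_psi0 sum_distrib_left mult.assoc)
qed

theorem theorem4p1:
  fixes s :: nat and \<alpha> :: "nat \<Rightarrow> complex"
  assumes "s \<ge> 1"
  shows "is_haar_wavelet (\<lambda>x. \<Sum>k<2^s. \<alpha> k * haar_psi0 (x - of_nat k / 2 ^ s)) \<longleftrightarrow>
    (\<exists>\<gamma>::nat \<Rightarrow> complex. (\<forall>r<2^s. cmod (\<gamma> r) = 1) \<and>
      (\<forall>k<2^s. \<alpha> k = (- 1) ^ k / 2 ^ s *
        (\<Sum>r<2^s. \<gamma> r * exp (- \<i> * of_real pi * (of_nat (2 * r + 1) / 2 ^ s) * of_nat k))))"
proof -
  define \<psi> where "\<psi> = (\<lambda>x. \<Sum>k<2^s. \<alpha> k * haar_psi0 (x - of_nat k / 2 ^ s))"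
  have N: "(2::nat) ^ s > 0" "even ((2::nat) ^ s)" using assms by auto
  have inner: "l2_inner (\<lambda>x. \<psi> (x - a)) (\<lambda>x. \<psi> (x - b))
    = (\<Sum>k<2^s. \<Sum>l<2^s. \<alpha> k * cnj (\<alpha> l) * haar_psi0 (a - b + of_nat k / 2 ^ s - of_nat l / 2 ^ s))" for a b
    unfolding \<psi>_def by (rule l2_inner_haar_combination)
  have "is_haar_wavelet \<psi> \<longleftrightarrow> (\<forall>r<2^s. cmod (symbol (2 ^ s) \<alpha> r) = 1)"
  proof
    assume "is_haar_wavelet \<psi>"
    hence orth: "l2_inner (\<lambda>x. \<psi> (x - a)) (\<lambda>x. \<psi> (x - b)) = (if a = b then 1 else 0)"
      if "a \<in> I2" "b \<in> I2" for a b
      using that by (auto simp: is_haar_wavelet_def is_orthonormal_basis_def)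
    have "(\<Sum>k<2^s. \<Sum>l<2^s. \<alpha> k * cnj (\<alpha> l) * antiperiod (2 ^ s) (int m + int k - int l))
        = (if m = 0 then 1 else 0)" if m: "m < 2 ^ s" for m
    proof -
      \<comment> \<open>The index pairs \<open>m / 2^s\<close> and 0 give as many equations as there
        are unknown moduli of the symbol.\<close>
      have "of_nat m / 2 ^ s \<in> I2" unfolding I2_eq using m by blast
      moreover have "0 \<in> I2" unfolding I2_eq by (intro CollectI exI[of _ 0]) simp
      ultimately have "l2_inner (\<lambda>x. \<psi> (x - of_nat m / 2 ^ s)) (\<lambda>x. \<psi> (x - 0)) = (if m = 0 then 1 else 0)"
        by (subst orth) auto
      thus ?thesis unfolding inner by (simp add: autocorrelation_dyadic[symmetric])
    qed
    thus "\<forall>r<2^s. cmod (symbol (2 ^ s) \<alpha> r) = 1" using unimodular_symbol[OF N] by blast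
  next
    assume "\<forall>r<2^s. cmod (symbol (2 ^ s) \<alpha> r) = 1"
    hence reproduce: "(\<Sum>k<2^s. \<Sum>l<2^s. \<alpha> k * cnj (\<alpha> l) * haar_psi0 (b + of_nat k / 2 ^ s - of_nat l / 2 ^ s))
      = haar_psi0 b" for b
      using autocorrelation_q2[OF assms] by blast
    \<comment> \<open>The sign \<open>haar_psi0 z\<close> is the same for every summand of
      \<open>\<psi>\<close>, so translation by Z2 acts on \<open>\<psi>\<close> as on
      \<open>haar_psi0\<close>, and \<open>I2\<close> suffices for the span.\<close>
    have "\<psi> (x - z) = haar_psi0 z * \<psi> x" if "norm2 z \<le> 1" for x z
    proof -
      have "haar_psi0 (x - z - of_nat k / 2 ^ s) = haar_psi0 z * haar_psi0 (x - of_nat k / 2 ^ s)" for k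
        using haar_psi0_shift[OF that, of "x - of_nat k / 2 ^ s"] by (simp add: algebra_simps)
      thus ?thesis by (simp add: \<psi>_def sum_distrib_left mult.left_commute)
    qed
    hence I2_span: "cspan ((\<lambda>a x. \<psi> (x - a)) ` I2) = cspan (translates \<psi>)"
      by (intro cspan_translates_eq_I2) blast
    have psi_span: "translates \<psi> \<subseteq> cspan (translates haar_psi0)"
      unfolding translates_def \<psi>_def diff_diff_eq
      by (intro image_subsetI cspan_sum) (rule translate_in_cspan[unfolded translates_def])
    have "translates haar_psi0 \<subseteq> cspan (translates \<psi>)"
    proof
      fix g assume "g \<in> translates haar_psi0"
      then obtain b where g: "g = (\<lambda>x. haar_psi0 (x - b))" by (auto simp: translates_def)
      \<comment> \<open>This is \<open>p(U)* p(U) = 1\<close> applied to a translate of psi0: the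
        coefficients \<open>cnj (\<alpha> l)\<close> and backward shifts of the adjoint. It is
        \<open>reproduce\<close> at \<open>b - x\<close>, where evenness of \<open>haar_psi0\<close>
        restores the sign of the argument.\<close>
      have "haar_psi0 (x - b) = (\<Sum>l<2^s. cnj (\<alpha> l) * \<psi> (x - (b - of_nat l / 2 ^ s)))" for x
      proof -
        have "haar_psi0 (x - b) = (\<Sum>k<2^s. \<Sum>l<2^s. \<alpha> k * cnj (\<alpha> l) * haar_psi0 (b - x + of_nat k / 2 ^ s - of_nat l / 2 ^ s))"
          using haar_psi0_uminus[of "x - b"] reproduce[of "b - x"] by simp
        also have "\<dots> = (\<Sum>l<2^s. \<Sum>k<2^s. \<alpha> k * cnj (\<alpha> l) * haar_psi0 (b - x + of_nat k / 2 ^ s - of_nat l / 2 ^ s))"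
          by (rule sum.swap)
        also have "\<dots> = (\<Sum>l<2^s. cnj (\<alpha> l) * \<psi> (x - (b - of_nat l / 2 ^ s)))"
        proof -
          have "haar_psi0 (b - x + of_nat k / 2 ^ s - of_nat l / 2 ^ s)
              = haar_psi0 (x - (b - of_nat l / 2 ^ s) - of_nat k / 2 ^ s)" for k l
            using haar_psi0_uminus[of "b - x + of_nat k / 2 ^ s - of_nat l / 2 ^ s"] by (simp add: algebra_simps)
          thus ?thesis by (simp add: \<psi>_def sum_distrib_left mult_ac)
        qed
        finally show ?thesis .
      qed
      thus "g \<in> cspan (translates \<psi>)"
        unfolding g by (simp only:) (rule cspan_sum, rule translate_in_cspan)
    qed
    hence W0: "l2_closure (cspan ((\<lambda>a x. \<psi> (x - a)) ` I2)) = haar_W0"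
      unfolding I2_span haar_W0_eq using psi_span cspan_least by (metis subset_antisym)
    have mem: "(\<lambda>x. \<psi> (x - a)) \<in> haar_W0" for a
    proof -
      have "(\<lambda>x. \<psi> (x - a)) \<in> cspan (translates haar_psi0)"
        using psi_span by (auto simp: translates_def)
      thus ?thesis unfolding haar_W0_eq using l2_closure_superset cspan_subset_L2[OF translates_L2(3)] by blast
    qed
    \<comment> \<open>By \<open>reproduce\<close> the inner products of the translates are
      \<open>haar_psi0 (a - b)\<close>, the Kronecker delta on \<open>I2\<close>.\<close>
    show "is_haar_wavelet \<psi>"
      unfolding is_haar_wavelet_def is_orthonormal_basis_def inner reproduce
      using mem[of 0] mem W0 by (auto simp: haar_psi0_I2)
  qed
  also have "\<dots> \<longleftrightarrow> (\<exists>\<gamma>. (\<forall>r<2^s. cmod (\<gamma> r) = 1) \<and>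
      (\<forall>k<2^s. \<alpha> k = (\<Sum>r<2^s. \<gamma> r * root_pow (2 ^ s) r (- int k)) / of_nat (2 ^ s)))"
    by (rule symbol_inversion[OF N, symmetric])
  \<comment> \<open>An equality of functions of \<open>\<gamma>\<close> and \<open>k\<close>, so
    that it can be substituted below the quantifiers.\<close>
  also have "(\<lambda>\<gamma> k. (\<Sum>r<2^s. \<gamma> r * root_pow (2 ^ s) r (- int k)) / of_nat (2 ^ s))
    = (\<lambda>\<gamma> k. (- 1) ^ k / 2 ^ s *
        (\<Sum>r<2^s. \<gamma> r * exp (- \<i> * of_real pi * (of_nat (2 * r + 1) / 2 ^ s) * of_nat k)))"
    by (intro ext) (simp add: root_pow_eq_exp[OF N(1)] sum_distrib_left sum_divide_distrib mult_ac)
  finally show ?thesis unfolding \<psi>_def .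
qed

end
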